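(* Let $T\in\mathcal F$ be a trigraph with no balanced skew-partition, and let $(A_1,B_1,C_1,A_2,B_2,C_2)$ be a split of a $2$-join $(X_1,X_2)$ of $T$. Then: (i) $(X_1,X_2)$ is a proper $2$-join; and for $i=1,2$: (ii) every vertex of $X_i$ has a neighbor in $X_i$; (iii) every vertex of $A_i$ has an antineighbor in $B_i$; (iv) every vertex of $B_i$ has an antineighbor in $A_i$; (v) every vertex of $A_i$ has a neighbor in $C_i\cup B_i$; (vi) every vertex of $B_i$ has a neighbor in $C_i\cup A_i$; (vii) if $C_i=\emptyset$ then $|A_i|\ge2$ and $|B_i|\ge2$; (viii) $|X_i|\ge4$.
   Context: A trigraph $T$ consists of a finite vertex set $V(T)$ and a map $\theta:\binom{V(T)}{2}\to\{-1,0,1\}$. Distinct $u,v$ are strongly adjacent if $\theta(uv)=1$, strongly antiadjacent if $\theta(uv)=-1$, and form a switchable pair if $\theta(uv)=0$; adjacent (so $u$ is a neighbor of $v$) if $\theta(uv)\in\{0,1\}$, antiadjacent (antineighbor) if $\theta(uv)\in\{-1,0\}$. The complement $\overline T$ has adjacency $-\theta$; $T|X$ is the induced trigraph on $X$. Strongly complete/anticomplete: strongly adjacent/antiadjacent to every vertex of the set. The full realization of $T$ is the graph on $V(T)$ whose edges are adjacent pairs. $X$ is connected if the full realization of $T|X$ is connected, anticonnected if the complement of the graph on $X$ of strongly adjacent pairs is connected; components are maximal connected subsets. Paths: sequences $p_1,\dots,p_k$ of distinct vertices, consecutive ones adjacent and non-consecutive ones antiadjacent (length $k-1$, interior the inner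 vertices). Holes: $h_1,\dots,h_k$, $k\ge4$, with $h_i,h_j$ adjacent iff $|i-j|\in\{1,k-1\}$, antiadjacent otherwise (length $k$). Antipaths/antiholes: induced subtrigraphs whose complement is a path/hole of $\overline T$. Berge: no odd hole, no odd antihole. A skew-partition is a partition $(A,B)$ of $V(T)$ with $A$ not connected and $B$ not anticonnected; balanced if there is no path of odd length $>1$ with ends in $B$ and interior in $A$ and no antipath of odd length $>1$ with ends in $A$ and interior in $B$. $\mathcal F$: with $\Sigma(T)$ the graph of switchable pairs, $T\in\mathcal F$ iff $T$ is Berge, each component of $\Sigma(T)$ has at most two edges, and every vertex $v$ of degree two in $\Sigma(T)$ with $\Sigma(T)$-neighbours $x,y$ is either strongly complete to $V(T)\setminus\{v,x,y\}$ with $x,y$ strongly adjacent, or strongly anticomplete to $V(T)\setminus\{v,x,y\}$ with $x,y$ strongly antiadjacent. A $2$-join of $T$ is a partition $(X_1,X_2)$ of $V(T)$ for which there are disjoint sets $A_1,B_1,C_1,A_2,B_2,C_2$ (a split) with $X_i=A_i\cup B_i\cup C_i$, $A_1,A_2,B_1,B_2$ nonempty, no switchable pair meeting both $X_1$ and $X_2$, $A_1$ strongly complete to $A_2$, $B_1$ strongly complete to $B_2$, no other strong edges between $X_1$ and $X_2$, $|X_i|\ge3$, and for $i=1,2$, if $|A_i|=|B_i|=1$ then the full realization of $T|X_i$ is not a path of length two joining the vertex of $A_i$ to the vertex of $B_i$. It is proper if for $i=1,2$ every component of $T|X_i$ meets both $A_i$ and $B_i$. *)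

theory Defs
  imports Main
begin

record 'a ugraph =
  uverts :: "'a set"
  uedges :: "'a set set"

definition ug_induced :: "'a ugraph \<Rightarrow> 'a set \<Rightarrow> 'a ugraph" where
  "ug_induced G X = \<lparr>uverts = uverts G \<inter> X, uedges = {e \<in> uedges G. e \<subseteq> X}\<rparr>"

definition ug_complement :: "'a ugraph \<Rightarrow> 'a ugraph" where
  "ug_complement G =
     \<lparr>uverts = uverts G,
      uedges = {{u, v} | u v. u \<in> uverts G \<and> v \<in> uverts G \<and> u \<noteq> v} - uedges G\<rparr>"

text \<open>The graph with no vertices counts as connected, so that a side of a skew-partition
  (not connected, resp.\ not anticonnected) always has at least two vertices.\<close>

definition ug_connected :: "'a ugraph \<Rightarrow> bool" where
  "ug_connected G \<longleftrightarrow>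
     (\<forall>u \<in> uverts G. \<forall>v \<in> uverts G. (u, v) \<in> {(x, y). {x, y} \<in> uedges G}\<^sup>*)"

definition ug_components :: "'a ugraph \<Rightarrow> 'a set set" where
  "ug_components G =
     {K. K \<noteq> {} \<and> K \<subseteq> uverts G \<and> ug_connected (ug_induced G K) \<and>
         (\<forall>K'. K \<subseteq> K' \<and> K' \<subseteq> uverts G \<and> ug_connected (ug_induced G K') \<longrightarrow> K' = K)}"

definition ug_neighbors :: "'a ugraph \<Rightarrow> 'a \<Rightarrow> 'a set" where
  "ug_neighbors G v = {u. {u, v} \<in> uedges G}"

definition ug_degree :: "'a ugraph \<Rightarrow> 'a \<Rightarrow> nat" where
  "ug_degree G v = card (ug_neighbors G v)"

text \<open>The whole graph \<open>G\<close> is a path with vertices \<open>p\<close> in this order.\<close>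

definition ug_is_path :: "'a ugraph \<Rightarrow> 'a list \<Rightarrow> bool" where
  "ug_is_path G p \<longleftrightarrow>
     p \<noteq> [] \<and> distinct p \<and> uverts G = set p \<and>
     uedges G = {{p ! i, p ! Suc i} | i. Suc i < length p}"


text \<open>The function \<open>\<theta>\<close> is only meaningful on two-element subsets of the vertex set.\<close>

record 'a trigraph =
  tverts :: "'a set"
  theta :: "'a set \<Rightarrow> int"

definition is_trigraph :: "'a trigraph \<Rightarrow> bool" where
  "is_trigraph T \<longleftrightarrow>
     finite (tverts T) \<and>
     (\<forall>e. e \<subseteq> tverts T \<and> card e = 2 \<longrightarrow> theta T e \<in> {-1, 0, 1})"

definition vpair :: "'a trigraph \<Rightarrow> 'a \<Rightarrow> 'a \<Rightarrow> bool" where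
  "vpair T u v \<longleftrightarrow> u \<in> tverts T \<and> v \<in> tverts T \<and> u \<noteq> v"

definition strongly_adjacent :: "'a trigraph \<Rightarrow> 'a \<Rightarrow> 'a \<Rightarrow> bool" where
  "strongly_adjacent T u v \<longleftrightarrow> vpair T u v \<and> theta T {u, v} = 1"

definition strongly_antiadjacent :: "'a trigraph \<Rightarrow> 'a \<Rightarrow> 'a \<Rightarrow> bool" where
  "strongly_antiadjacent T u v \<longleftrightarrow> vpair T u v \<and> theta T {u, v} = -1"

definition switchable :: "'a trigraph \<Rightarrow> 'a \<Rightarrow> 'a \<Rightarrow> bool" where
  "switchable T u v \<longleftrightarrow> vpair T u v \<and> theta T {u, v} = 0"

definition adjacent :: "'a trigraph \<Rightarrow> 'a \<Rightarrow> 'a \<Rightarrow> bool" where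
  "adjacent T u v \<longleftrightarrow> vpair T u v \<and> theta T {u, v} \<in> {0, 1}"

definition antiadjacent :: "'a trigraph \<Rightarrow> 'a \<Rightarrow> 'a \<Rightarrow> bool" where
  "antiadjacent T u v \<longleftrightarrow> vpair T u v \<and> theta T {u, v} \<in> {-1, 0}"

definition tri_complement :: "'a trigraph \<Rightarrow> 'a trigraph" where
  "tri_complement T = \<lparr>tverts = tverts T, theta = (\<lambda>e. - theta T e)\<rparr>"

definition tri_induced :: "'a trigraph \<Rightarrow> 'a set \<Rightarrow> 'a trigraph" where
  "tri_induced T X = \<lparr>tverts = tverts T \<inter> X, theta = theta T\<rparr>"

definition strongly_complete :: "'a trigraph \<Rightarrow> 'a set \<Rightarrow> 'a set \<Rightarrow> bool" where
  "strongly_complete T X Y \<longleftrightarrow> (\<forall>x \<in> X. \<forall>y \<in> Y. strongly_adjacent T x y)"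

definition strongly_anticomplete :: "'a trigraph \<Rightarrow> 'a set \<Rightarrow> 'a set \<Rightarrow> bool" where
  "strongly_anticomplete T X Y \<longleftrightarrow> (\<forall>x \<in> X. \<forall>y \<in> Y. strongly_antiadjacent T x y)"

definition full_realization :: "'a trigraph \<Rightarrow> 'a ugraph" where
  "full_realization T = \<lparr>uverts = tverts T, uedges = {{u, v} | u v. adjacent T u v}\<rparr>"

definition strong_graph :: "'a trigraph \<Rightarrow> 'a ugraph" where
  "strong_graph T = \<lparr>uverts = tverts T, uedges = {{u, v} | u v. strongly_adjacent T u v}\<rparr>"

definition switchable_graph :: "'a trigraph \<Rightarrow> 'a ugraph" where
  "switchable_graph T = \<lparr>uverts = tverts T, uedges = {{u, v} | u v. switchable T u v}\<rparr>"

definition tri_connected :: "'a trigraph \<Rightarrow> 'a set \<Rightarrow> bool" where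
  "tri_connected T X \<longleftrightarrow> ug_connected (full_realization (tri_induced T X))"

definition tri_anticonnected :: "'a trigraph \<Rightarrow> 'a set \<Rightarrow> bool" where
  "tri_anticonnected T X \<longleftrightarrow> ug_connected (ug_complement (strong_graph (tri_induced T X)))"

definition tri_components :: "'a trigraph \<Rightarrow> 'a set set" where
  "tri_components T = ug_components (full_realization T)"

text \<open>In paths and holes a switchable pair may play either role: consecutive vertices need only
  be adjacent and non-consecutive ones need only be antiadjacent.\<close>

definition tri_path :: "'a trigraph \<Rightarrow> 'a list \<Rightarrow> bool" where
  "tri_path T p \<longleftrightarrow>
     p \<noteq> [] \<and> distinct p \<and> set p \<subseteq> tverts T \<and>
     (\<forall>i j. i < j \<and> j < length p \<longrightarrow>
        (if j = Suc i then adjacent T (p ! i) (p ! j) else antiadjacent T (p ! i) (p ! j)))"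

definition path_length :: "'a list \<Rightarrow> nat" where
  "path_length p = length p - 1"

definition path_ends :: "'a list \<Rightarrow> 'a set" where
  "path_ends p = {hd p, last p}"

definition path_interior :: "'a list \<Rightarrow> 'a set" where
  "path_interior p = set (butlast (tl p))"

definition tri_hole :: "'a trigraph \<Rightarrow> 'a list \<Rightarrow> bool" where
  "tri_hole T h \<longleftrightarrow>
     length h \<ge> 4 \<and> distinct h \<and> set h \<subseteq> tverts T \<and>
     (\<forall>i j. i < j \<and> j < length h \<longrightarrow>
        (if j - i \<in> {1, length h - 1} then adjacent T (h ! i) (h ! j)
         else antiadjacent T (h ! i) (h ! j)))"

definition tri_antipath :: "'a trigraph \<Rightarrow> 'a list \<Rightarrow> bool" where
  "tri_antipath T p \<longleftrightarrow> tri_path (tri_complement T) p"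

definition tri_antihole :: "'a trigraph \<Rightarrow> 'a list \<Rightarrow> bool" where
  "tri_antihole T h \<longleftrightarrow> tri_hole (tri_complement T) h"

definition Berge :: "'a trigraph \<Rightarrow> bool" where
  "Berge T \<longleftrightarrow>
     \<not> (\<exists>h. tri_hole T h \<and> odd (length h)) \<and>
     \<not> (\<exists>h. tri_antihole T h \<and> odd (length h))"

definition skew_partition :: "'a trigraph \<Rightarrow> 'a set \<Rightarrow> 'a set \<Rightarrow> bool" where
  "skew_partition T A B \<longleftrightarrow>
     A \<union> B = tverts T \<and> A \<inter> B = {} \<and> \<not> tri_connected T A \<and> \<not> tri_anticonnected T B"

definition balanced_skew_partition :: "'a trigraph \<Rightarrow> 'a set \<Rightarrow> 'a set \<Rightarrow> bool" where
  "balanced_skew_partition T A B \<longleftrightarrow>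
     skew_partition T A B \<and>
     \<not> (\<exists>p. tri_path T p \<and> odd (path_length p) \<and> path_length p > 1 \<and>
            path_ends p \<subseteq> B \<and> path_interior p \<subseteq> A) \<and>
     \<not> (\<exists>p. tri_antipath T p \<and> odd (path_length p) \<and> path_length p > 1 \<and>
            path_ends p \<subseteq> A \<and> path_interior p \<subseteq> B)"

definition class_F :: "'a trigraph set" where
  "class_F =
     {T. is_trigraph T \<and> Berge T \<and>
         (\<forall>K \<in> ug_components (switchable_graph T).
            card (uedges (ug_induced (switchable_graph T) K)) \<le> 2) \<and>
         (\<forall>v \<in> tverts T. \<forall>x y.
            ug_degree (switchable_graph T) v = 2 \<and>
            ug_neighbors (switchable_graph T) v = {x, y} \<longrightarrow>
              (strongly_complete T {v} (tverts T - {v, x, y}) \<and> strongly_adjacent T x y) \<or>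
              (strongly_anticomplete T {v} (tverts T - {v, x, y}) \<and>
               strongly_antiadjacent T x y))}"

text \<open>The conditions on a split that concern only one side.\<close>

definition two_join_side ::
    "'a trigraph \<Rightarrow> 'a set \<Rightarrow> 'a set \<Rightarrow> 'a set \<Rightarrow> 'a set \<Rightarrow> bool" where
  "two_join_side T X A B C \<longleftrightarrow>
     X = A \<union> B \<union> C \<and> A \<inter> B = {} \<and> A \<inter> C = {} \<and> B \<inter> C = {} \<and>
     A \<noteq> {} \<and> B \<noteq> {} \<and> card X \<ge> 3 \<and>
     (card A = 1 \<and> card B = 1 \<longrightarrow>
        \<not> (\<exists>p. ug_is_path (full_realization (tri_induced T X)) p \<and> path_length p = 2 \<and>
               hd p \<in> A \<and> last p \<in> B))"

definition two_join_split ::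
    "'a trigraph \<Rightarrow> 'a set \<Rightarrow> 'a set \<Rightarrow>
     'a set \<Rightarrow> 'a set \<Rightarrow> 'a set \<Rightarrow> 'a set \<Rightarrow> 'a set \<Rightarrow> 'a set \<Rightarrow> bool" where
  "two_join_split T X1 X2 A1 B1 C1 A2 B2 C2 \<longleftrightarrow>
     X1 \<union> X2 = tverts T \<and> X1 \<inter> X2 = {} \<and>
     two_join_side T X1 A1 B1 C1 \<and> two_join_side T X2 A2 B2 C2 \<and>
     (\<forall>x \<in> X1. \<forall>y \<in> X2. \<not> switchable T x y) \<and>
     strongly_complete T A1 A2 \<and> strongly_complete T B1 B2 \<and>
     (\<forall>x \<in> X1. \<forall>y \<in> X2. strongly_adjacent T x y \<longrightarrow>
        (x \<in> A1 \<and> y \<in> A2) \<or> (x \<in> B1 \<and> y \<in> B2))"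

definition two_join :: "'a trigraph \<Rightarrow> 'a set \<Rightarrow> 'a set \<Rightarrow> bool" where
  "two_join T X1 X2 \<longleftrightarrow> (\<exists>A1 B1 C1 A2 B2 C2. two_join_split T X1 X2 A1 B1 C1 A2 B2 C2)"

text \<open>The split of a 2-join is determined up to exchanging the roles of \<open>A\<close> and \<open>B\<close>, so
  properness does not depend on the split; it is required here for every split.\<close>

definition proper_two_join :: "'a trigraph \<Rightarrow> 'a set \<Rightarrow> 'a set \<Rightarrow> bool" where
  "proper_two_join T X1 X2 \<longleftrightarrow>
     two_join T X1 X2 \<and>
     (\<forall>A1 B1 C1 A2 B2 C2. two_join_split T X1 X2 A1 B1 C1 A2 B2 C2 \<longrightarrow>
        (\<forall>K \<in> tri_components (tri_induced T X1). K \<inter> A1 \<noteq> {} \<and> K \<inter> B1 \<noteq> {}) \<and>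
        (\<forall>K \<in> tri_components (tri_induced T X2). K \<inter> A2 \<noteq> {} \<and> K \<inter> B2 \<noteq> {}))"

end

theory Submission
  imports Defs
begin

text \<open>In a Berge trigraph, a star cutset whose centre \<open>v\<close> has an antineighbour yields a balanced
  skew-partition: either all strong neighbours of \<open>v\<close> together with \<open>v\<close> still form a cutset, or
  \<open>v\<close> dominates some vertex \<open>x\<close> and \<open>x\<close> is cut off by the other strong neighbours of \<open>v\<close>. In both
  cases an odd path or antipath violating balance would be closed by \<open>v\<close> to an odd hole or antihole.
  Almost every failure of the asserted properties of a 2-join exhibits such a star cutset.

  Three cases need more. If \<open>a \<in> A\<^sub>1\<close> has no neighbour in \<open>B\<^sub>1 \<union> C\<^sub>1\<close>, then \<open>(A\<^sub>1 - {a}) \<union> A\<^sub>2\<close> is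
  the non-anticonnected side of a balanced skew-partition: a violating path with ends in \<open>A\<^sub>1\<close> meets
  \<open>X\<^sub>2\<close> in at most one vertex \<open>b\<^sub>2 \<in> B\<^sub>2\<close>, so an antineighbour of \<open>b\<^sub>2\<close> in \<open>A\<^sub>2\<close> closes it. If
  \<open>C\<^sub>1\<close> is empty and \<open>B\<^sub>1\<close> is a single vertex, that vertex forms switchable pairs with at least two
  vertices of \<open>A\<^sub>1\<close>, against the definition of the class. If \<open>|X\<^sub>1| = 3\<close>, then \<open>A\<^sub>1\<close> and \<open>B\<^sub>1\<close> are
  joined by paths of length one and two through a switchable pair, and one of these closes to an odd
  hole through \<open>X\<^sub>2\<close>.\<close>

section \<open>Adjacency under complementation and in induced subtrigraphs\<close>

lemma complement_simps [simp]:
  "tverts (tri_complement T) = tverts T"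
  "vpair (tri_complement T) u v \<longleftrightarrow> vpair T u v"
  "adjacent (tri_complement T) u v \<longleftrightarrow> antiadjacent T u v"
  "antiadjacent (tri_complement T) u v \<longleftrightarrow> adjacent T u v"
  "strongly_adjacent (tri_complement T) u v \<longleftrightarrow> strongly_antiadjacent T u v"
  "strongly_antiadjacent (tri_complement T) u v \<longleftrightarrow> strongly_adjacent T u v"
  "strongly_complete (tri_complement T) X Y \<longleftrightarrow> strongly_anticomplete T X Y"
  "strongly_anticomplete (tri_complement T) X Y \<longleftrightarrow> strongly_complete T X Y"
  by (auto simp: tri_complement_def vpair_def adjacent_def antiadjacent_def strongly_adjacent_def
      strongly_antiadjacent_def strongly_complete_def strongly_anticomplete_def)

lemma tri_complement_involutive [simp]: "tri_complement (tri_complement T) = T"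
  by (simp add: tri_complement_def)

lemma Berge_complement [simp]: "Berge (tri_complement T) \<longleftrightarrow> Berge T"
  by (auto simp: Berge_def tri_antihole_def)

lemma adjacent_commute: "adjacent T u v \<longleftrightarrow> adjacent T v u"
  and antiadjacent_commute: "antiadjacent T u v \<longleftrightarrow> antiadjacent T v u"
  and strongly_adjacent_commute: "strongly_adjacent T u v \<longleftrightarrow> strongly_adjacent T v u"
  and switchable_commute: "switchable T u v \<longleftrightarrow> switchable T v u"
  by (auto simp: vpair_def adjacent_def antiadjacent_def strongly_adjacent_def switchable_def
      insert_commute)

lemma adjacent_irrefl [simp]: "\<not> adjacent T u u"
  and antiadjacent_irrefl [simp]: "\<not> antiadjacent T u u"
  by (auto simp: vpair_def adjacent_def antiadjacent_def)

lemma strongly_adjacent_imp_adjacent: "strongly_adjacent T u v \<Longrightarrow> adjacent T u v"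
  by (simp add: strongly_adjacent_def adjacent_def)

lemma adjacent_in_tverts: "adjacent T u v \<Longrightarrow> u \<in> tverts T \<and> v \<in> tverts T"
  by (simp add: adjacent_def vpair_def)

lemma switchable_iff: "switchable T u v \<longleftrightarrow> adjacent T u v \<and> antiadjacent T u v"
  by (auto simp: switchable_def adjacent_def antiadjacent_def)

lemma strongly_antiadjacent_imp_antiadjacent: "strongly_antiadjacent T u v \<Longrightarrow> antiadjacent T u v"
  by (simp add: strongly_antiadjacent_def antiadjacent_def)

lemma theta_values:
  assumes "is_trigraph T" "vpair T u v"
  shows "theta T {u, v} \<in> {-1, 0, 1}"
  using assms by (auto simp: is_trigraph_def vpair_def)

lemma strongly_antiadjacent_iff:
  assumes "is_trigraph T"
  shows "strongly_antiadjacent T u v \<longleftrightarrow> vpair T u v \<and> \<not> adjacent T u v"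
  using theta_values[OF assms, of u v]
  by (auto simp: strongly_antiadjacent_def adjacent_def)

lemma strongly_adjacent_iff:
  assumes "is_trigraph T"
  shows "strongly_adjacent T u v \<longleftrightarrow> vpair T u v \<and> \<not> antiadjacent T u v"
  using theta_values[OF assms, of u v]
  by (auto simp: strongly_adjacent_def antiadjacent_def)

lemma induced_simps [simp]:
  "tverts (tri_induced T X) = tverts T \<inter> X"
  "adjacent (tri_induced T X) u v \<longleftrightarrow> adjacent T u v \<and> u \<in> X \<and> v \<in> X"
  "strongly_adjacent (tri_induced T X) u v \<longleftrightarrow> strongly_adjacent T u v \<and> u \<in> X \<and> v \<in> X"
  by (auto simp: tri_induced_def vpair_def adjacent_def strongly_adjacent_def)

lemma edge_simps [simp]:
  "{u, v} \<in> uedges (full_realization T) \<longleftrightarrow> adjacent T u v"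
  "{u, v} \<in> uedges (strong_graph T) \<longleftrightarrow> strongly_adjacent T u v"
  "{u, v} \<in> uedges (switchable_graph T) \<longleftrightarrow> switchable T u v"
  by (auto simp: full_realization_def strong_graph_def switchable_graph_def doubleton_eq_iff
      intro: adjacent_commute[THEN iffD1] strongly_adjacent_commute[THEN iffD1]
      switchable_commute[THEN iffD1])

lemma uverts_simps [simp]:
  "uverts (full_realization T) = tverts T"
  "uverts (strong_graph T) = tverts T"
  "uverts (switchable_graph T) = tverts T"
  by (auto simp: full_realization_def strong_graph_def switchable_graph_def)

section \<open>Odd paths through a set\<close>

text \<open>One predicate serves both balance conditions: an offending antipath is an offending path
  of the complement, with the two sides of the skew-partition exchanged.\<close>

definition odd_path_through :: "'a trigraph \<Rightarrow> 'a set \<Rightarrow> 'a set \<Rightarrow> 'a list \<Rightarrow> bool" where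
  "odd_path_through T S R p \<longleftrightarrow>
     tri_path T p \<and> odd (path_length p) \<and> path_length p > 1 \<and>
     path_ends p \<subseteq> S \<and> path_interior p \<subseteq> R"

lemma balanced_skew_partition_iff:
  "balanced_skew_partition T A B \<longleftrightarrow>
     skew_partition T A B \<and> (\<nexists>p. odd_path_through T B A p) \<and>
     (\<nexists>p. odd_path_through (tri_complement T) A B p)"
  by (simp add: balanced_skew_partition_def odd_path_through_def tri_antipath_def)

lemma path_interior_nth:
  "path_interior p = {p ! i | i. 0 < i \<and> Suc i < length p}"
proof -
  have "x \<in> path_interior p \<longleftrightarrow> (\<exists>i. 0 < i \<and> Suc i < length p \<and> x = p ! i)" for x
  proof
    assume "x \<in> path_interior p"
    then obtain j where j: "j < length p - 2" "x = butlast (tl p) ! j"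
      by (auto simp: path_interior_def in_set_conv_nth numeral_2_eq_2)
    then have "x = p ! Suc j" by (simp add: nth_butlast nth_tl)
    then show "\<exists>i. 0 < i \<and> Suc i < length p \<and> x = p ! i" using j by (intro exI[of _ "Suc j"]) auto
  next
    assume "\<exists>i. 0 < i \<and> Suc i < length p \<and> x = p ! i"
    then obtain i where i: "0 < i" "Suc i < length p" "x = p ! i" by blast
    then have "x = butlast (tl p) ! (i - 1)" by (simp add: nth_butlast nth_tl)
    moreover have "i - 1 < length (butlast (tl p))" using i by simp
    ultimately show "x \<in> path_interior p" unfolding path_interior_def using nth_mem by metis
  qed
  then show ?thesis by blast
qed

lemma odd_path_through_iff:
  "odd_path_through T S R p \<longleftrightarrow>
     even (length p) \<and> length p \<ge> 4 \<and> tri_path T p \<and>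
     p ! 0 \<in> S \<and> p ! (length p - 1) \<in> S \<and> (\<forall>i. 0 < i \<longrightarrow> Suc i < length p \<longrightarrow> p ! i \<in> R)"
proof (cases "p = []")
  case False
  have *: "odd (path_length p) \<and> path_length p > 1 \<longleftrightarrow> even (length p) \<and> length p \<ge> 4"
    using False by (cases p) (auto simp: path_length_def elim!: oddE)
  have **: "path_ends p = {p ! 0, p ! (length p - 1)}"
    using False by (simp add: path_ends_def hd_conv_nth last_conv_nth)
  show ?thesis
    unfolding odd_path_through_def ** path_interior_nth using * by auto
qed (simp add: odd_path_through_def tri_path_def)

lemma tri_path_nth_adjacent:
  "tri_path T p \<Longrightarrow> Suc i < length p \<Longrightarrow> adjacent T (p ! i) (p ! Suc i)"
  unfolding tri_path_def by (metis lessI)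

lemma tri_path_nth_antiadjacent:
  "tri_path T p \<Longrightarrow> Suc i < j \<Longrightarrow> j < length p \<Longrightarrow> antiadjacent T (p ! i) (p ! j)"
  unfolding tri_path_def by (metis Suc_lessD nat_neq_iff)

text \<open>Closing an odd path with a vertex adjacent to its ends and antiadjacent to its interior
  yields an odd hole.\<close>

lemma odd_path_through_no_apex:
  assumes "Berge T" and p: "odd_path_through T S R p"
    and ends: "adjacent T v (p ! 0)" "adjacent T v (p ! (length p - 1))"
    and inner: "\<And>i. 0 < i \<Longrightarrow> Suc i < length p \<Longrightarrow> antiadjacent T v (p ! i)"
  shows False
proof -
  let ?n = "length p"
  have n: "even ?n" "?n \<ge> 4" and path: "tri_path T p"
    using p by (auto simp: odd_path_through_iff)
  have "v \<noteq> p ! i" if "i < ?n" for i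
  proof (cases "i = 0 \<or> i = ?n - 1")
    case True
    then show ?thesis using ends by auto
  next
    case False
    then have "antiadjacent T v (p ! i)" using that by (intro inner) auto
    then show ?thesis by auto
  qed
  then have "v \<notin> set p" by (auto simp: in_set_conv_nth)
  then have "distinct (v # p)" "set (v # p) \<subseteq> tverts T"
    using path adjacent_in_tverts[OF ends(1)] by (auto simp: tri_path_def)
  moreover have "if j - i \<in> {1, length (v # p) - 1} then adjacent T ((v # p) ! i) ((v # p) ! j)
         else antiadjacent T ((v # p) ! i) ((v # p) ! j)"
    if ij: "i < j" "j < length (v # p)" for i j
  proof (cases i)
    case 0
    then obtain k where k: "j = Suc k" "k < ?n" using ij by (cases j) auto
    consider "k = 0" | "k = ?n - 1" | "0 < k" "Suc k < ?n" using k(2) by linarith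
    then show ?thesis using ends inner[of k] 0 k n by cases auto
  next
    case (Suc i')
    then obtain k where k: "j = Suc k" "i' < k" "k < ?n" using ij by (cases j) auto
    then show ?thesis
      using Suc n tri_path_nth_adjacent[OF path, of i'] tri_path_nth_antiadjacent[OF path, of i' k]
      by (cases "k = Suc i'") auto
  qed
  moreover have "length (v # p) \<ge> 4" using n by simp
  ultimately have "tri_hole T (v # p)" unfolding tri_hole_def by blast
  then show False using \<open>Berge T\<close> n by (auto simp: Berge_def)
qed

text \<open>The form used on whole parts of a partition. Since complementing exchanges adjacent and
  antiadjacent, the same \<open>v\<close> also excludes odd antipaths with ends in \<open>R\<close>
  and interior in \<open>S\<close>.\<close>

lemma no_odd_path_through_apex:
  assumes "Berge T" "\<And>s. s \<in> S \<Longrightarrow> adjacent T v s" "\<And>r. r \<in> R \<Longrightarrow> antiadjacent T v r"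
  shows "\<not> odd_path_through T S R p"
  using odd_path_through_no_apex[OF assms(1), of S R p v] assms(2,3)
  by (auto simp: odd_path_through_iff)

text \<open>An odd path of length greater than one has two different ends and at least two interior
  vertices, so a one-vertex part of a skew-partition can host neither.\<close>

lemma no_odd_path_through_singleton_ends [simp]: "\<not> odd_path_through T {x} R p"
proof
  assume "odd_path_through T {x} R p"
  then have "length p \<ge> 4" "distinct p" "p ! 0 = p ! (length p - 1)"
    by (auto simp: odd_path_through_iff tri_path_def)
  then show False by (subst (asm) nth_eq_iff_index_eq) auto
qed

lemma no_odd_path_through_singleton_interior [simp]: "\<not> odd_path_through T S {x} p"
proof
  assume "odd_path_through T S {x} p"
  then have "length p \<ge> 4" "distinct p" "p ! 1 = x" "p ! 2 = x"
    by (auto simp: odd_path_through_iff tri_path_def)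
  then show False using nth_eq_iff_index_eq[of p 1 2] by auto
qed

text \<open>The ends are antiadjacent, so they cannot be divided between \<open>M\<close> and
  \<open>N\<close>. Consecutive interior vertices are adjacent, so the interior cannot cross between
  \<open>P\<close> and \<open>Q\<close>.\<close>

lemma odd_path_through_split:
  assumes p: "odd_path_through T (M \<union> N) (P \<union> Q) p"
    and MN: "\<And>m n. m \<in> M \<Longrightarrow> n \<in> N \<Longrightarrow> \<not> antiadjacent T m n"
    and PQ: "\<And>m n. m \<in> P \<Longrightarrow> n \<in> Q \<Longrightarrow> \<not> adjacent T m n"
  shows "\<exists>S \<in> {M, N}. \<exists>R \<in> {P, Q}. odd_path_through T S R p"
proof -
  let ?n = "length p"
  have path: "tri_path T p" and n: "?n \<ge> 4"
    and int: "\<And>i. 0 < i \<Longrightarrow> Suc i < ?n \<Longrightarrow> p ! i \<in> P \<union> Q"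
    using p by (auto simp: odd_path_through_iff)
  have "antiadjacent T (p ! 0) (p ! (?n - 1))"
    using tri_path_nth_antiadjacent[OF path, of 0 "?n - 1"] n by simp
  moreover have "p ! 0 \<in> M \<union> N" "p ! (?n - 1) \<in> M \<union> N"
    using p by (auto simp: odd_path_through_iff)
  ultimately have "p ! 0 \<in> M \<and> p ! (?n - 1) \<in> M \<or> p ! 0 \<in> N \<and> p ! (?n - 1) \<in> N"
    using MN antiadjacent_commute[of T "p ! 0"] by blast
  then obtain S where S: "S \<in> {M, N}" "p ! 0 \<in> S" "p ! (?n - 1) \<in> S" by blast
  obtain R where R: "R \<in> {P, Q}" "p ! 1 \<in> R" using int[of 1] n by auto
  have "p ! i \<in> R" if "0 < i" "Suc i < ?n" for i
    using that
  proof (induction i rule: nat_induct_non_zero)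
    case (Suc i)
    then have "p ! i \<in> R" "adjacent T (p ! i) (p ! Suc i)" "p ! Suc i \<in> P \<union> Q"
      using tri_path_nth_adjacent[OF path, of i] int[of "Suc i"] by auto
    then show ?case using R(1) PQ adjacent_commute[of T "p ! i"] by blast
  qed (use R in simp)
  then have "odd_path_through T S R p" using p S by (simp add: odd_path_through_iff)
  then show ?thesis using R S by blast
qed

section \<open>Skew-partitions\<close>

lemma not_ug_connectedI:
  assumes "u \<in> uverts G" "v \<in> uverts G" "u \<in> P" "v \<notin> P"
    and closed: "\<And>x y. {x, y} \<in> uedges G \<Longrightarrow> x \<in> P \<Longrightarrow> y \<in> P"
  shows "\<not> ug_connected G"
proof
  assume "ug_connected G"
  then have "(u, v) \<in> {(x, y). {x, y} \<in> uedges G}\<^sup>*" using assms by (simp add: ug_connected_def)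
  then have "v \<in> P" using \<open>u \<in> P\<close> by (induction rule: rtrancl_induct) (use closed in auto)
  then show False using \<open>v \<notin> P\<close> by simp
qed

lemma not_tri_connectedI:
  assumes "strongly_anticomplete T P Q" "P \<noteq> {}" "Q \<noteq> {}"
  shows "\<not> tri_connected T (P \<union> Q)"
proof -
  obtain u v where uv: "u \<in> P" "v \<in> Q" using assms by blast
  have "x \<in> tverts T" "y \<in> tverts T" "\<not> adjacent T x y" "y \<notin> P" if "x \<in> P" "y \<in> Q" for x y
    using that assms(1)
    by (auto simp: strongly_anticomplete_def strongly_antiadjacent_def adjacent_def vpair_def)
  then show ?thesis
    using uv unfolding tri_connected_def by (intro not_ug_connectedI[of u _ v P]) auto
qed

lemma not_tri_anticonnectedI:
  assumes "strongly_complete T M N" "M \<noteq> {}" "N \<noteq> {}"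
  shows "\<not> tri_anticonnected T (M \<union> N)"
proof -
  obtain u v where uv: "u \<in> M" "v \<in> N" using assms by blast
  have MN: "x \<in> tverts T" "y \<in> tverts T" "strongly_adjacent T x y" "y \<notin> M"
    if "x \<in> M" "y \<in> N" for x y
    using that assms(1) by (auto simp: strongly_complete_def strongly_adjacent_def vpair_def)
  let ?G = "ug_complement (strong_graph (tri_induced T (M \<union> N)))"
  have verts: "uverts ?G = tverts T \<inter> (M \<union> N)" by (simp add: ug_complement_def)
  have "y \<in> M" if "{x, y} \<in> uedges ?G" "x \<in> M" for x y
  proof -
    have "y \<in> M \<union> N" "\<not> strongly_adjacent T x y \<or> x \<notin> M \<union> N \<or> y \<notin> M \<union> N"
      using that by (auto simp: ug_complement_def doubleton_eq_iff)
    then show ?thesis using MN that by blast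
  qed
  moreover have "u \<in> uverts ?G" "v \<in> uverts ?G" "v \<notin> M" using uv MN[OF uv] verts by auto
  ultimately show ?thesis
    unfolding tri_anticonnected_def using not_ug_connectedI[of u ?G v M] uv(1) by blast
qed

text \<open>By \<open>odd_path_through_split\<close>, balance has to be checked only for one part of
  each side at a time.\<close>

lemma balanced_skew_partitionI:
  assumes T: "is_trigraph T"
    and part: "M \<union> N \<union> P \<union> Q = tverts T" "(M \<union> N) \<inter> (P \<union> Q) = {}"
    and ne: "M \<noteq> {}" "N \<noteq> {}" "P \<noteq> {}" "Q \<noteq> {}"
    and MN: "strongly_complete T M N" and PQ: "strongly_anticomplete T P Q"
    and no_path: "\<And>S R p. S \<in> {M, N} \<Longrightarrow> R \<in> {P, Q} \<Longrightarrow> \<not> odd_path_through T S R p"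
    and no_antipath: "\<And>S R p. S \<in> {M, N} \<Longrightarrow> R \<in> {P, Q} \<Longrightarrow>
      \<not> odd_path_through (tri_complement T) R S p"
  shows "balanced_skew_partition T (P \<union> Q) (M \<union> N)"
proof -
  have MN': "\<not> antiadjacent T m n" if "m \<in> M" "n \<in> N" for m n
    using MN that strongly_adjacent_iff[OF T, of m n] by (auto simp: strongly_complete_def)
  have PQ': "\<not> adjacent T m n" if "m \<in> P" "n \<in> Q" for m n
    using PQ that strongly_antiadjacent_iff[OF T, of m n] by (auto simp: strongly_anticomplete_def)
  have "\<not> odd_path_through T (M \<union> N) (P \<union> Q) p" for p
    using odd_path_through_split[OF _ MN' PQ', where p = p] no_path by blast
  moreover have "\<not> odd_path_through (tri_complement T) (P \<union> Q) (M \<union> N) p" for p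
  proof
    assume "odd_path_through (tri_complement T) (P \<union> Q) (M \<union> N) p"
    \<comment> \<open>In the complement \<open>P\<close> and \<open>Q\<close> become the complete
      pair and \<open>M\<close> and \<open>N\<close> the anticomplete one, so the splitting lemma
      applies with the two pairs exchanged.\<close>
    from odd_path_through_split[OF this] show False
      using MN' PQ' no_antipath by (metis complement_simps(3,4))
  qed
  moreover have "skew_partition T (P \<union> Q) (M \<union> N)"
    using part not_tri_connectedI[OF PQ ne(3,4)] not_tri_anticonnectedI[OF MN ne(1,2)]
    by (auto simp: skew_partition_def)
  ultimately show ?thesis by (simp add: balanced_skew_partition_iff)
qed

text \<open>The sides are \<open>x\<close> with all antineighbors of \<open>v\<close>, and
  \<open>v\<close> with its other strong neighbors. Here \<open>x\<close> is isolated in the first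
  side, \<open>v\<close> is complete to the rest of the second, and \<open>v\<close> is an apex for
  every odd path or antipath that could spoil balance.\<close>

lemma dominated_vertex_balanced:
  assumes T: "is_trigraph T" "Berge T"
    and vx: "strongly_adjacent T v x"
    and dom: "\<And>z. antiadjacent T v z \<Longrightarrow> \<not> adjacent T x z"
    and z: "antiadjacent T v z" and y: "strongly_adjacent T v y" "y \<noteq> x"
  shows "\<exists>A B. balanced_skew_partition T A B"
proof -
  \<comment> \<open>\<open>N\<close> and \<open>Z\<close> partition the vertices other than
    \<open>v\<close>; a vertex forming a switchable pair with \<open>v\<close> falls into
    \<open>Z\<close>.\<close>
  define N where "N = {u. strongly_adjacent T v u}"
  define Z where "Z = {u. antiadjacent T v u}"
  have split: "vpair T v u \<longleftrightarrow> u \<in> N \<union> Z" "u \<notin> N \<inter> Z" for u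
    using strongly_adjacent_iff[OF T(1), of v u] by (auto simp: N_def Z_def antiadjacent_def)
  have v: "v \<in> tverts T" using vx by (auto simp: strongly_adjacent_def vpair_def)
  have [simp]: "v \<notin> N" "v \<notin> Z" by (auto simp: N_def Z_def strongly_adjacent_def vpair_def)
  have V: "tverts T = {v} \<union> N \<union> Z" using split v unfolding vpair_def by blast
  have x: "x \<in> N" "x \<notin> Z" using vx split(2) by (auto simp: N_def)
  have "balanced_skew_partition T ({x} \<union> Z) ({v} \<union> (N - {x}))"
  proof (rule balanced_skew_partitionI)
    show "strongly_complete T {v} (N - {x})" by (auto simp: strongly_complete_def N_def)
    show "strongly_anticomplete T {x} Z"
      using dom x V strongly_antiadjacent_iff[OF T(1), of x]
      by (auto simp: strongly_anticomplete_def Z_def vpair_def)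
    \<comment> \<open>The combinations involving \<open>{v}\<close> or \<open>{x}\<close> are
      excluded by size, so only \<open>N - {x}\<close> against \<open>Z\<close> remains.\<close>
    have "\<not> odd_path_through T (N - {x}) Z p" for p
      using T(2) strongly_adjacent_imp_adjacent
      by (intro no_odd_path_through_apex[of _ _ v]) (auto simp: N_def Z_def)
    then show "\<not> odd_path_through T S R p" if "S \<in> {{v}, N - {x}}" "R \<in> {{x}, Z}" for S R p
      using that by auto
    have "\<not> odd_path_through (tri_complement T) Z (N - {x}) p" for p
      using T(2) strongly_adjacent_imp_adjacent
      by (intro no_odd_path_through_apex[of _ _ v]) (auto simp: N_def Z_def)
    then show "\<not> odd_path_through (tri_complement T) R S p"
      if "S \<in> {{v}, N - {x}}" "R \<in> {{x}, Z}" for S R p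
      using that by auto
    show "({v} \<union> (N - {x})) \<inter> ({x} \<union> Z) = {}" using x split(2) by auto
    show "{v} \<union> (N - {x}) \<union> {x} \<union> Z = tverts T" using x V by auto
  qed (use T z y in \<open>auto simp: Z_def N_def\<close>)
  then show ?thesis by blast
qed

text \<open>Enlarge the star \<open>B\<close> to \<open>{v} \<union> N\<close>, with all strong
  neighbors of \<open>v\<close>. If antineighbors of \<open>v\<close> survive on both sides, this is
  still a cutset and \<open>v\<close> is the required apex. If one side is absorbed by
  \<open>N\<close>, then \<open>v\<close> dominates its vertices. The vertex \<open>y\<close> keeps
  the strong neighborhood of \<open>v\<close> nonempty after the dominated vertex is
  removed.\<close>

lemma star_cutset_balanced:
  assumes T: "is_trigraph T" "Berge T"
    and sub: "B \<subseteq> tverts T" "P \<subseteq> tverts T" "P \<inter> B = {}"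
    and B: "v \<in> B" "y \<in> B" "y \<noteq> v" "\<And>b. b \<in> B \<Longrightarrow> b \<noteq> v \<Longrightarrow> strongly_adjacent T v b"
    and P: "x \<in> P" and Q: "q \<in> tverts T" "q \<notin> P" "q \<notin> B"
    and sep: "\<And>x q. x \<in> P \<Longrightarrow> q \<in> tverts T \<Longrightarrow> q \<notin> P \<Longrightarrow> q \<notin> B \<Longrightarrow> \<not> adjacent T x q"
    and z: "antiadjacent T v z"
  shows "\<exists>A B. balanced_skew_partition T A B"
proof -
  define N where "N = {u. strongly_adjacent T v u}"
  define Z where "Z = {u. antiadjacent T v u}"
  define Q' where "Q' = tverts T - P - B"
  have split: "vpair T v u \<longleftrightarrow> u \<in> N \<union> Z" "u \<notin> N \<inter> Z" for u
    using strongly_adjacent_iff[OF T(1), of v u] by (auto simp: N_def Z_def antiadjacent_def)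
  have v: "v \<in> tverts T" using B sub by blast
  have [simp]: "v \<notin> N" "v \<notin> Z" by (auto simp: N_def Z_def strongly_adjacent_def vpair_def)
  have V: "tverts T = {v} \<union> N \<union> Z" using split v unfolding vpair_def by blast
  have BN: "B \<subseteq> {v} \<union> N" using B by (auto simp: N_def)
  have ZPQ: "Z \<subseteq> P \<union> Q'" using BN V split(2) by (auto simp: Q'_def)
  have PQ: "\<not> adjacent T a b" if "a \<in> P" "b \<in> Q'" for a b using sep that by (auto simp: Q'_def)
  consider "P \<inter> Z = {}" | "Q' \<inter> Z = {}" | "P \<inter> Z \<noteq> {}" "Q' \<inter> Z \<noteq> {}" by blast
  then show ?thesis
  proof cases
    \<comment> \<open>All of \<open>P\<close> is strongly adjacent to \<open>v\<close>, and the
      antineighbors of \<open>v\<close> lie beyond the cutset, out of reach of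
      \<open>x\<close>.\<close>
    case 1
    have "x \<in> tverts T" "x \<notin> Z" "x \<noteq> v" using 1 P sub B(1) by auto
    then have xN: "x \<in> N" using V by simp
    have "\<not> adjacent T x u" if "antiadjacent T v u" for u
      using that 1 ZPQ PQ[OF P, of u] by (auto simp: Z_def)
    moreover have "y \<noteq> x" using P B(2) sub by blast
    ultimately show ?thesis
      using xN dominated_vertex_balanced[OF T, of v x z y] z B(2,3) B(4)[of y] by (simp add: N_def)
  next
    case 2
    have q: "q \<in> Q'" using Q by (simp add: Q'_def)
    then have qN: "q \<in> N" using 2 V B(1) by (auto simp: Q'_def)
    have "\<not> adjacent T q u" if "antiadjacent T v u" for u
      using that 2 ZPQ PQ[OF _ q, of u] adjacent_commute[of T u q] by (auto simp: Z_def)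
    moreover have "y \<noteq> q" using Q B(2) by blast
    ultimately show ?thesis
      using qN dominated_vertex_balanced[OF T, of v q z y] z B(2,3) B(4)[of y] by (simp add: N_def)
  next
    case 3
    have "balanced_skew_partition T ((P \<inter> Z) \<union> (Q' \<inter> Z)) ({v} \<union> N)"
    proof (rule balanced_skew_partitionI)
      show "strongly_complete T {v} N" by (auto simp: strongly_complete_def N_def)
      show "strongly_anticomplete T (P \<inter> Z) (Q' \<inter> Z)"
        using PQ sub strongly_antiadjacent_iff[OF T(1)]
        by (auto simp: strongly_anticomplete_def Q'_def vpair_def)
      have "\<not> odd_path_through T N R p" if "R \<in> {P \<inter> Z, Q' \<inter> Z}" for p R
        using T(2) strongly_adjacent_imp_adjacent that
        by (intro no_odd_path_through_apex[of _ _ v]) (auto simp: N_def Z_def)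
      then show "\<not> odd_path_through T S R p" if "S \<in> {{v}, N}" "R \<in> {P \<inter> Z, Q' \<inter> Z}" for S R p
        using that by auto
      have "\<not> odd_path_through (tri_complement T) R N p" if "R \<in> {P \<inter> Z, Q' \<inter> Z}" for p R
        using T(2) strongly_adjacent_imp_adjacent that
        by (intro no_odd_path_through_apex[of _ _ v]) (auto simp: N_def Z_def)
      then show "\<not> odd_path_through (tri_complement T) R S p"
        if "S \<in> {{v}, N}" "R \<in> {P \<inter> Z, Q' \<inter> Z}" for S R p
        using that by auto
      show "({v} \<union> N) \<inter> (P \<inter> Z \<union> Q' \<inter> Z) = {}" using split(2) by auto
      show "{v} \<union> N \<union> P \<inter> Z \<union> Q' \<inter> Z = tverts T" using V ZPQ by auto
      show "N \<noteq> {}" using B(2-4) by (auto simp: N_def)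
    qed (use T 3 in auto)
    then show ?thesis by blast
  qed
qed

section \<open>2-joins\<close>

text \<open>The path condition in the definition of a 2-join is left out, which makes the two symmetries
  below immediate.\<close>

locale unbalanced_two_join =
  fixes T :: "'a trigraph" and X1 A1 B1 C1 X2 A2 B2 C2 :: "'a set"
  assumes trigraph: "is_trigraph T" and Berge: "Berge T"
    and no_balanced: "\<not> (\<exists>A B. balanced_skew_partition T A B)"
    and verts: "X1 \<union> X2 = tverts T" "X1 \<inter> X2 = {}"
    and side1: "X1 = A1 \<union> B1 \<union> C1" "A1 \<inter> B1 = {}" "A1 \<inter> C1 = {}" "B1 \<inter> C1 = {}"
      "A1 \<noteq> {}" "B1 \<noteq> {}" "card X1 \<ge> 3"
    and side2: "X2 = A2 \<union> B2 \<union> C2" "A2 \<inter> B2 = {}" "A2 \<inter> C2 = {}" "B2 \<inter> C2 = {}"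
      "A2 \<noteq> {}" "B2 \<noteq> {}" "card X2 \<ge> 3"
    and cross_adjacent: "x \<in> X1 \<Longrightarrow> y \<in> X2 \<Longrightarrow>
      adjacent T x y \<longleftrightarrow> (x \<in> A1 \<and> y \<in> A2) \<or> (x \<in> B1 \<and> y \<in> B2)"
    and cross_not_switchable: "x \<in> X1 \<Longrightarrow> y \<in> X2 \<Longrightarrow> \<not> switchable T x y"
begin

lemma swap_AB: "unbalanced_two_join T X1 B1 A1 C1 X2 B2 A2 C2"
  using trigraph Berge no_balanced verts side1 side2 cross_adjacent cross_not_switchable
  by unfold_locales (auto simp: Un_commute Int_commute)

lemma swap_12: "unbalanced_two_join T X2 A2 B2 C2 X1 A1 B1 C1"
proof unfold_locales
  show "adjacent T x y \<longleftrightarrow> (x \<in> A2 \<and> y \<in> A1) \<or> (x \<in> B2 \<and> y \<in> B1)" if "x \<in> X2" "y \<in> X1" for x y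
    using cross_adjacent[OF that(2,1)] adjacent_commute[of T x] by auto
  show "\<not> switchable T x y" if "x \<in> X2" "y \<in> X1" for x y
    using cross_not_switchable[OF that(2,1)] switchable_commute[of T x] by auto
qed (use trigraph Berge no_balanced verts side1 side2 in auto)

lemma in_tverts:
  "x \<in> A1 \<Longrightarrow> x \<in> tverts T" "x \<in> B1 \<Longrightarrow> x \<in> tverts T" "x \<in> C1 \<Longrightarrow> x \<in> tverts T"
  "x \<in> A2 \<Longrightarrow> x \<in> tverts T" "x \<in> B2 \<Longrightarrow> x \<in> tverts T" "x \<in> C2 \<Longrightarrow> x \<in> tverts T"
  using verts side1(1) side2(1) by auto

lemma sub: "A1 \<subseteq> X1" "B1 \<subseteq> X1" "C1 \<subseteq> X1" "A2 \<subseteq> X2" "B2 \<subseteq> X2" "C2 \<subseteq> X2"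
  using side1(1) side2(1) by auto

lemma disj:
  "x \<in> A1 \<Longrightarrow> x \<notin> B1" "x \<in> A1 \<Longrightarrow> x \<notin> C1" "x \<in> B1 \<Longrightarrow> x \<notin> C1"
  "x \<in> A2 \<Longrightarrow> x \<notin> B2" "x \<in> A2 \<Longrightarrow> x \<notin> C2" "x \<in> B2 \<Longrightarrow> x \<notin> C2"
  "x \<in> X1 \<Longrightarrow> x \<notin> X2"
  using side1(2-4) side2(2-4) verts(2) by auto

lemma in_X1_cases: "x \<in> X1 \<Longrightarrow> x \<in> A1 \<or> x \<in> B1 \<or> x \<in> C1"
  using side1(1) by auto

lemma in_tverts_cases: "x \<in> tverts T \<Longrightarrow> x \<in> X1 \<or> x \<in> X2"
  using verts(1) by auto

lemma cross_antiadjacent: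
  assumes "x \<in> X1" "y \<in> X2"
  shows "antiadjacent T x y \<longleftrightarrow> \<not> ((x \<in> A1 \<and> y \<in> A2) \<or> (x \<in> B1 \<and> y \<in> B2))"
proof -
  have "vpair T x y" using assms verts by (auto simp: vpair_def)
  then show ?thesis
    using cross_adjacent[OF assms] cross_not_switchable[OF assms]
      strongly_antiadjacent_iff[OF trigraph, of x y] strongly_antiadjacent_imp_antiadjacent[of T x y]
    by (auto simp: switchable_iff)
qed

lemma cross_strongly_adjacent:
  "x \<in> A1 \<Longrightarrow> y \<in> A2 \<Longrightarrow> strongly_adjacent T x y"
  "x \<in> B1 \<Longrightarrow> y \<in> B2 \<Longrightarrow> strongly_adjacent T x y"
  using cross_antiadjacent[of x y] verts side1(1) side2(1)
  by (auto simp: strongly_adjacent_iff[OF trigraph] vpair_def)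

lemma no_star_cutset:
  assumes "v \<in> B" "y \<in> B" "y \<noteq> v" "B \<subseteq> tverts T"
    and "\<And>b. b \<in> B \<Longrightarrow> b \<noteq> v \<Longrightarrow> strongly_adjacent T v b"
    and "P \<subseteq> tverts T" "P \<inter> B = {}" "x \<in> P"
    and "q \<in> tverts T" "q \<notin> P" "q \<notin> B"
    and "\<And>x q. x \<in> P \<Longrightarrow> q \<in> tverts T \<Longrightarrow> q \<notin> P \<Longrightarrow> q \<notin> B \<Longrightarrow> \<not> adjacent T x q"
    and "antiadjacent T v z"
  shows False
  using star_cutset_balanced[OF trigraph Berge, of B P v y x q z] no_balanced assms by blast

lemma side1_not_pair: "\<not> X1 \<subseteq> {x, y}"
proof
  assume "X1 \<subseteq> {x, y}"
  then have "card X1 \<le> card {x, y}" by (intro card_mono) auto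
  then show False using side1(7) card_insert_le_m1[of 2 "{y}" x] by simp
qed

text \<open>Such a \<open>K\<close> would have no neighbors outside itself at all, so any strong
  edge outside \<open>K\<close>, here \<open>a2\<close> with \<open>a1\<close>, is a star cutset
  separating \<open>K\<close> from \<open>b2\<close>.\<close>

lemma closed_meets_A1_or_B1:
  assumes K: "K \<subseteq> X1" "k \<in> K"
    and closed: "\<And>x y. x \<in> K \<Longrightarrow> y \<in> X1 \<Longrightarrow> y \<notin> K \<Longrightarrow> \<not> adjacent T x y"
    and miss: "\<And>x. x \<in> K \<Longrightarrow> x \<notin> A1" "\<And>x. x \<in> K \<Longrightarrow> x \<notin> B1"
  shows False
proof -
  obtain a1 a2 b1 b2 where el: "a1 \<in> A1" "a2 \<in> A2" "b1 \<in> B1" "b2 \<in> B2"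
    using side1(5,6) side2(5,6) by blast
  show False
  proof (rule no_star_cutset)
    show "b2 \<notin> {a2, a1}" "b2 \<notin> K" "K \<inter> {a2, a1} = {}"
      using el sub K(1) miss disj(4,7) by blast+
    show "strongly_adjacent T a2 b" if "b \<in> {a2, a1}" "b \<noteq> a2" for b
      using that el cross_strongly_adjacent(1)[of a1 a2] by (auto simp: strongly_adjacent_commute)
    show "antiadjacent T a2 b1"
      using el sub cross_antiadjacent[of b1 a2] disj(1,4) antiadjacent_commute[of T a2]
      by blast
    show "\<not> adjacent T x q" if "x \<in> K" "q \<in> tverts T" "q \<notin> K" for x q
      using that closed[of x q] cross_adjacent[of x q] K(1) miss in_tverts_cases[of q] by blast
    show "a1 \<noteq> a2" using el sub disj(7) by blast
  qed (use el K verts sub in auto)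
qed

text \<open>A union \<open>K\<close> of components of \<open>X1\<close> that misses
  \<open>B1\<close> reaches \<open>X2\<close> only through \<open>A1\<close>. Successive star
  cutsets force \<open>K\<close> inside \<open>A1\<close>, then equal to \<open>A1\<close>, then
  down to one vertex. This exceptional outcome is eliminated in
  \<open>closed_meets_B1\<close>.\<close>

lemma closed_misses_B1:
  assumes K: "K \<subseteq> X1" "k \<in> K"
    and closed: "\<And>x y. x \<in> K \<Longrightarrow> y \<in> X1 \<Longrightarrow> y \<notin> K \<Longrightarrow> \<not> adjacent T x y"
    and miss: "\<And>x. x \<in> K \<Longrightarrow> x \<notin> B1"
  shows "\<exists>a. K = {a} \<and> A1 = {a}"
proof -
  obtain a1 a2 b1 b2 where el: "a1 \<in> K" "a1 \<in> A1" "a2 \<in> A2" "b1 \<in> B1" "b2 \<in> B2"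
    using side1(6) side2(5,6) closed_meets_A1_or_B1[OF K closed] miss by blast
  have "K \<subseteq> A1"
  proof (rule ccontr)
    assume "\<not> K \<subseteq> A1"
    \<comment> \<open>The star with centre \<open>a2\<close> and leaves \<open>K \<inter> A1\<close>
      would cut \<open>K \<inter> C1\<close> off from \<open>b2\<close>.\<close>
    then obtain c where c: "c \<in> K" "c \<in> C1" using K(1) in_X1_cases miss by blast
    show False
    proof (rule no_star_cutset)
      show "b2 \<notin> insert a2 (K \<inter> A1)" "b2 \<notin> K \<inter> C1" "K \<inter> C1 \<inter> insert a2 (K \<inter> A1) = {}"
        using el sub K(1) disj(2,4,7) by blast+
      show "strongly_adjacent T a2 b" if "b \<in> insert a2 (K \<inter> A1)" "b \<noteq> a2" for b
        using that el cross_strongly_adjacent(1)[of b a2] by (auto simp: strongly_adjacent_commute)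
      show "antiadjacent T a2 b1"
        using el sub cross_antiadjacent[of b1 a2] disj(1,4) antiadjacent_commute[of T a2]
        by blast
      show "\<not> adjacent T x q"
        if "x \<in> K \<inter> C1" "q \<in> tverts T" "q \<notin> K \<inter> C1" "q \<notin> insert a2 (K \<inter> A1)" for x q
      proof (cases "q \<in> X1")
        case True
        then show ?thesis using that closed[of x q] in_X1_cases[of q] miss by blast
      next
        case False
        then show ?thesis using that cross_adjacent[of x q] sub in_tverts_cases[of q] disj(2,3) by blast
      qed
      show "a1 \<noteq> a2" using el sub disj(7) by blast
      show "c \<in> K \<inter> C1" "a1 \<in> insert a2 (K \<inter> A1)" using c el by auto
    qed (use el K verts sub in auto)
  qed
  moreover have "A1 \<subseteq> K"
  proof
    fix a assume a: "a \<in> A1"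
    show "a \<in> K"
    proof (rule ccontr)
      \<comment> \<open>Now \<open>a\<close> together with \<open>A2\<close> would form a star
        cutting \<open>K\<close> off from \<open>b1\<close>.\<close>
      assume nK: "a \<notin> K"
      show False
      proof (rule no_star_cutset)
        show "b1 \<notin> insert a A2" "b1 \<notin> K" "K \<inter> insert a A2 = {}"
          using el sub disj(1,7) miss nK a K(1) by blast+
        show "strongly_adjacent T a b" if "b \<in> insert a A2" "b \<noteq> a" for b
          using that a cross_strongly_adjacent(1)[of a b] by auto
        show "antiadjacent T a b2"
          using el a sub cross_antiadjacent[of a b2] disj(1,4) by blast
        show "\<not> adjacent T x q" if "x \<in> K" "q \<in> tverts T" "q \<notin> K" "q \<notin> insert a A2" for x q
        proof (cases "q \<in> X1")
          case False
          moreover have "x \<notin> B1" using that miss by blast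
          ultimately show ?thesis using that cross_adjacent[of x q] K(1) in_tverts_cases[of q] by blast
        qed (use that closed in blast)
        show "a2 \<noteq> a" using a el sub disj(7) by blast
      qed (use el a K verts sub in auto)
    qed
  qed
  ultimately have KA: "K = A1" by blast
  have "x = a1" if x: "x \<in> A1" for x
  proof (rule ccontr)
    assume "x \<noteq> a1"
    \<comment> \<open>Removing \<open>x\<close> from the star keeps \<open>A1 - B\<close> nonempty
      even if \<open>x\<close> is strongly adjacent to \<open>a1\<close>. Neighbors of
      \<open>A1\<close> lie in \<open>A1\<close> or in \<open>A2\<close>, and \<open>A2\<close> is
      contained in \<open>B\<close>, so \<open>A1 - B\<close> is cut off from
      \<open>b1\<close>.\<close>
    define B where "B = insert a1 {u. strongly_adjacent T a1 u \<and> u \<noteq> x}"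
    have x2: "a2 \<noteq> a1" "a2 \<noteq> x" using el x sub disj(7) by blast+
    have nadj: "\<not> adjacent T a1 b1" using closed[of a1 b1] el sub miss by blast
    show False
    proof (rule no_star_cutset[where v = a1 and B = B and P = "A1 - B"])
      show "b1 \<notin> B" "b1 \<notin> A1 - B"
        using nadj strongly_adjacent_imp_adjacent[of T a1 b1] el disj(1) by (auto simp: B_def)
      show "strongly_adjacent T a1 b" if "b \<in> B" "b \<noteq> a1" for b using that by (simp add: B_def)
      show "x \<in> A1 - B" using x \<open>x \<noteq> a1\<close> by (simp add: B_def)
      show "antiadjacent T a1 b2"
        using el sub cross_antiadjacent[of a1 b2] disj(1,4) by blast
      show "B \<subseteq> tverts T"
        using in_tverts el by (auto simp: B_def strongly_adjacent_def vpair_def)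
      show "a2 \<in> B" using el x2 cross_strongly_adjacent(1)[of a1 a2] by (simp add: B_def)
      show "\<not> adjacent T y q" if "y \<in> A1 - B" "q \<in> tverts T" "q \<notin> A1 - B" "q \<notin> B" for y q
      proof (cases "q \<in> X1")
        case True
        then show ?thesis using that closed[of y q] KA by blast
      next
        case False
        then have "q \<notin> A2"
          using that cross_strongly_adjacent(1)[of a1 q] el x sub disj(7)[of x] by (auto simp: B_def)
        then show ?thesis using False that cross_adjacent[of y q] sub disj(1) in_tverts_cases[of q] by blast
      qed
    qed (use el x \<open>x \<noteq> a1\<close> x2 in_tverts in \<open>auto simp: B_def\<close>)
  qed
  then show ?thesis using KA el by blast
qed

text \<open>If \<open>K\<close> missed \<open>B1\<close>, then \<open>K = A1 = {a}\<close>. The rest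
  of \<open>X1\<close> is closed as well and misses \<open>A1\<close>, so by the symmetric statement
  it is a single vertex too, and \<open>X1\<close> would be too small.\<close>

lemma closed_meets_B1:
  assumes K: "K \<subseteq> X1" "k \<in> K"
    and closed: "\<And>x y. x \<in> K \<Longrightarrow> y \<in> X1 \<Longrightarrow> y \<notin> K \<Longrightarrow> \<not> adjacent T x y"
  shows "K \<inter> B1 \<noteq> {}"
proof
  assume miss: "K \<inter> B1 = {}"
  then obtain a where a: "K = {a}" "A1 = {a}" using closed_misses_B1[OF K closed] by blast
  obtain b where b: "b \<in> X1 - K" using side1(6) sub(2) miss by blast
  interpret swap: unbalanced_two_join T X1 B1 A1 C1 X2 B2 A2 C2 by (rule swap_AB)
  obtain b' where "X1 - K = {b'}"
  proof -
    have "\<not> adjacent T x y" if "x \<in> X1 - K" "y \<in> X1" "y \<notin> X1 - K" for x y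
      using closed[of y x] that by (simp add: adjacent_commute)
    then show thesis using swap.closed_misses_B1[of "X1 - K" b] b a that by auto
  qed
  then show False using side1_not_pair[of a b'] a by blast
qed

text \<open>Otherwise \<open>a\<close> is the centre of a star with leaves \<open>B1\<close> and
  \<open>A2\<close>, which cuts the rest of \<open>A1 \<union> C1\<close> off from
  \<open>b2\<close>. If there is no such rest, a star centred in \<open>B1\<close> takes
  over.\<close>

lemma antineighbor_in_B1:
  assumes a: "a \<in> A1"
  shows "\<exists>b \<in> B1. antiadjacent T a b"
proof (rule ccontr)
  assume contra: "\<not> (\<exists>b \<in> B1. antiadjacent T a b)"
  obtain a2 b2 where el: "a2 \<in> A2" "b2 \<in> B2" using side2(5,6) by blast
  have strong: "strongly_adjacent T a b" if "b \<in> B1" for b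
    using contra that a side1(2) in_tverts
    by (auto simp: strongly_adjacent_iff[OF trigraph] vpair_def)
  show False
  proof (cases "A1 \<union> C1 = {a}")
    case False
    then obtain x where x: "x \<in> A1 \<union> C1" "x \<noteq> a" using a by blast
    show False
    proof (rule no_star_cutset)
      show "b2 \<notin> insert a (B1 \<union> A2)" "b2 \<notin> A1 \<union> C1 - {a}"
          "(A1 \<union> C1 - {a}) \<inter> insert a (B1 \<union> A2) = {}"
        using el a sub disj by blast+
      show "strongly_adjacent T a b" if "b \<in> insert a (B1 \<union> A2)" "b \<noteq> a" for b
        using that a strong cross_strongly_adjacent(1) by auto
      show "antiadjacent T a b2"
        using el a sub cross_antiadjacent[of a b2] disj(1,4) by blast
      show "\<not> adjacent T x q"
        if "x \<in> A1 \<union> C1 - {a}" "q \<in> tverts T" "q \<notin> A1 \<union> C1 - {a}" "q \<notin> insert a (B1 \<union> A2)" for x q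
      proof -
        have "q \<in> X2" "q \<notin> A2" "x \<in> X1" "x \<notin> B1"
          using that in_tverts_cases[of q] in_X1_cases[of q] sub disj(1,3) by blast+
        then show ?thesis using cross_adjacent by blast
      qed
      show "a2 \<noteq> a" using a el sub disj(7) by blast
      show "a2 \<in> insert a (B1 \<union> A2)" using el by simp
    qed (use el a x in_tverts in auto)
  next
    case True
    obtain b where b: "b \<in> B1" using side1(6) by blast
    obtain b' where b': "b' \<in> B1" "b' \<noteq> b"
      using side1_not_pair[of a b] True in_X1_cases b by blast
    \<comment> \<open>The star at \<open>b'\<close> contains \<open>a\<close> and all of
      \<open>B2\<close>; leaving \<open>b\<close> out of it separates \<open>b\<close> from
      \<open>a2\<close>.\<close>
    define B where "B = insert b' {u. strongly_adjacent T b' u \<and> u \<noteq> b}"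
    have aB: "a \<in> B" "a \<noteq> b'" "a \<noteq> b"
      using strong[of b'] b' b a disj(1) by (auto simp: B_def strongly_adjacent_commute)
    have anti: "antiadjacent T b' a2"
      using el sub b' cross_antiadjacent[of b' a2] disj(1,4) by blast
    show False
    proof (rule no_star_cutset[where v = b' and B = B and P = "B1 - B"])
      have "a2 \<notin> B1" using el sub disj(7) by blast
      then show "a2 \<notin> B" "a2 \<notin> B1 - B"
        using anti strongly_adjacent_iff[OF trigraph, of b' a2] b' by (auto simp: B_def)
      show "strongly_adjacent T b' u" if "u \<in> B" "u \<noteq> b'" for u using that by (simp add: B_def)
      show "B \<subseteq> tverts T"
        using in_tverts b' by (auto simp: B_def strongly_adjacent_def vpair_def)
      show "\<not> adjacent T y q" if "y \<in> B1 - B" "q \<in> tverts T" "q \<notin> B1 - B" "q \<notin> B" for y q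
      proof -
        have "q \<notin> X1" using that True in_X1_cases[of q] aB by auto
        then have "q \<in> X2" using that in_tverts_cases by blast
        moreover have "q \<notin> B2"
          using that cross_strongly_adjacent(2)[of b' q] b b' sub disj(7)[of b] by (auto simp: B_def)
        moreover have "y \<in> X1" "y \<notin> A1" using that sub disj(1) by blast+
        ultimately show ?thesis using cross_adjacent by blast
      qed
      show "b \<in> B1 - B" using b b' by (auto simp: B_def)
    qed (use el b b' aB anti in_tverts in \<open>auto simp: B_def\<close>)
  qed
qed

text \<open>The vertex \<open>a\<close> is isolated in the side \<open>{a} \<union> Q\<close>, and
  \<open>A1 - {a}\<close> is complete to \<open>A2\<close> in the other side. The apex
  \<open>a\<close> handles paths with ends in \<open>A2\<close> and antipaths with interior in
  \<open>A2\<close>; for those using \<open>M\<close> an apex is found in \<open>A2\<close>.\<close>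

lemma neighbor_outside_A1:
  assumes a: "a \<in> A1"
  shows "\<exists>u \<in> C1 \<union> B1. adjacent T a u"
proof (rule ccontr)
  assume contra: "\<not> (\<exists>u \<in> C1 \<union> B1. adjacent T a u)"
  obtain a2 b1 where el: "a2 \<in> A2" "b1 \<in> B1" using side2(5) side1(6) by blast
  define M where "M = A1 - {a}"
  define Q where "Q = (B1 \<union> C1) \<union> (B2 \<union> C2)"
  interpret swap: unbalanced_two_join T X2 B2 A2 C2 X1 B1 A1 C1
    using unbalanced_two_join.swap_AB[OF swap_12] .
  have Q1: "x \<in> X1 \<and> x \<notin> A1" if "x \<in> B1 \<union> C1" for x using that sub disj(1,2) by blast
  have Q2: "x \<in> X2 \<and> x \<notin> A2" if "x \<in> B2 \<union> C2" for x using that sub disj(4,5) by blast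
  have QX: "x \<notin> X2 \<Longrightarrow> x \<in> B1 \<union> C1" "x \<in> X2 \<Longrightarrow> x \<in> B2 \<union> C2" if "x \<in> Q" for x
    using that Q1 Q2 disj(7) unfolding Q_def by blast+
  have Qa: "antiadjacent T a q" "strongly_antiadjacent T a q" if q: "q \<in> Q" for q
  proof -
    have "\<not> adjacent T a q"
    proof (cases "q \<in> B1 \<union> C1")
      case True
      then show ?thesis using contra by blast
    next
      case False
      then have "q \<in> B2 \<union> C2" using q by (auto simp: Q_def)
      then show ?thesis using cross_adjacent[of a q] Q2[of q] a sub disj(1) by blast
    qed
    moreover have "a \<noteq> q" "a \<in> tverts T" "q \<in> tverts T"
      using q a Q1 Q2 sub disj(7) in_tverts unfolding Q_def by blast+
    then have "vpair T a q" by (simp add: vpair_def)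
    ultimately show "strongly_antiadjacent T a q" by (simp add: strongly_antiadjacent_iff[OF trigraph])
    then show "antiadjacent T a q" by (rule strongly_antiadjacent_imp_antiadjacent)
  qed
  have A2a: "adjacent T a x" "strongly_adjacent T a x" if "x \<in> A2" for x
    using cross_strongly_adjacent(1)[OF a that] strongly_adjacent_imp_adjacent by auto
  have A1_A2: "adjacent T y x" "strongly_adjacent T x y" if "x \<in> A1" "y \<in> A2" for x y
    using cross_strongly_adjacent(1)[OF that] strongly_adjacent_imp_adjacent[of T y x]
    by (auto simp: strongly_adjacent_commute)
  have anti: "antiadjacent T y x" if "x \<in> B1 \<union> C1" "y \<in> A2" for x y
    using Q1[OF that(1)] that(2) cross_antiadjacent[of x y] sub disj(4) antiadjacent_commute[of T x y]
    by blast
  \<comment> \<open>Otherwise \<open>{a}\<close> would be closed in \<open>X1\<close> while missing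
    \<open>B1\<close>.\<close>
  have "M \<noteq> {}"
  proof
    assume "M = {}"
    then have "A1 = {a}" using a by (auto simp: M_def)
    then have "{a} \<inter> B1 \<noteq> {}"
      using closed_meets_B1[of "{a}" a] contra sub(1) in_X1_cases by auto
    then show False using a disj(1) by blast
  qed
  have no_path: "\<not> odd_path_through T M Q p" for p
  proof
    assume p: "odd_path_through T M Q p"
    let ?n = "length p"
    have n: "?n \<ge> 4" and path: "tri_path T p" and ends: "p ! 0 \<in> A1" "p ! (?n - 1) \<in> A1"
      and int: "\<And>i. 0 < i \<Longrightarrow> Suc i < ?n \<Longrightarrow> p ! i \<in> Q"
      using p by (auto simp: odd_path_through_iff M_def)
    \<comment> \<open>All of \<open>A2\<close> is adjacent to the ends, so only antiadjacency to the
      interior has to be arranged.\<close>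
    have "\<exists>w \<in> A2. \<forall>i. 0 < i \<longrightarrow> Suc i < ?n \<longrightarrow> antiadjacent T w (p ! i)"
    proof (cases "\<exists>i < ?n. p ! i \<in> X2")
      case False
      then have "p ! i \<in> B1 \<union> C1" if "0 < i" "Suc i < ?n" for i
        using QX(1)[OF int[OF that]] that by auto
      then show ?thesis using anti el by blast
    next
      case True
      define I where "I = {i. i < ?n \<and> p ! i \<in> X2}"
      have I: "finite I" "I \<noteq> {}" using True by (auto simp: I_def)
      \<comment> \<open>\<open>k\<close> and \<open>m\<close> are the first and last positions in
        \<open>X2\<close>. The ends lie in \<open>X1\<close> and the interior avoids
        \<open>A2\<close>, so the path enters and leaves \<open>X2\<close> along edges between
        \<open>B1\<close> and \<open>B2\<close>.\<close>
      define k where "k = Min I"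
      define m where "m = Max I"
      have k: "k < ?n" "p ! k \<in> X2" using Min_in[OF I] by (auto simp: I_def k_def)
      have m: "m < ?n" "p ! m \<in> X2" using Max_in[OF I] by (auto simp: I_def m_def)
      have km: "k \<le> i \<and> i \<le> m" if "i < ?n" "p ! i \<in> X2" for i
        using I that by (auto simp: I_def k_def m_def)
      have inner: "0 < i \<and> Suc i < ?n \<and> p ! i \<notin> A2" if "i < ?n" "p ! i \<in> X2" for i
      proof -
        have "p ! 0 \<notin> X2" "p ! (?n - 1) \<notin> X2" using ends sub disj(7) by blast+
        then have "i \<noteq> 0" "i \<noteq> ?n - 1" using that by metis+
        then have i: "0 < i" "Suc i < ?n" using that by auto
        then have "p ! i \<in> B2 \<union> C2" using QX(2)[OF int[OF i]] that(2) by blast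
        then show ?thesis using Q2 i by blast
      qed
      have in_X1: "p ! i \<in> X1" if "i < ?n" "i < k \<or> m < i" for i
      proof -
        have "p ! i \<in> tverts T" using path nth_mem[OF that(1)] by (auto simp: tri_path_def)
        moreover have "p ! i \<notin> X2" using km[OF that(1)] that(2) by linarith
        ultimately show ?thesis using in_tverts_cases by blast
      qed
      have "p ! (k - 1) \<in> X1" "adjacent T (p ! (k - 1)) (p ! k)"
        using in_X1[of "k - 1"] inner[OF k] tri_path_nth_adjacent[OF path, of "k - 1"] k by auto
      then have kB: "p ! k \<in> B2" using cross_adjacent k(2) inner[OF k] by blast
      have "p ! Suc m \<in> X1" "adjacent T (p ! Suc m) (p ! m)"
        using in_X1[of "Suc m"] inner[OF m] tri_path_nth_adjacent[OF path, of m]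
        by (auto simp: adjacent_commute)
      then have "p ! Suc m \<in> B1" using cross_adjacent m(2) inner[OF m] by blast
      \<comment> \<open>The entry vertex in \<open>B2\<close> and the first vertex after the exit,
        in \<open>B1\<close>, are strongly adjacent, hence consecutive on the path: only one vertex
        lies in \<open>X2\<close>.\<close>
      then have "\<not> antiadjacent T (p ! k) (p ! Suc m)"
        using kB cross_strongly_adjacent(2) strongly_adjacent_iff[OF trigraph]
          antiadjacent_commute[of T] by blast
      then have "m = k"
        using tri_path_nth_antiadjacent[OF path, of k "Suc m"] km[OF k] inner[OF m] by linarith
      \<comment> \<open>This is the antineighbor property already proved, read for \<open>X2\<close>
        with the letters exchanged.\<close>
      obtain w where w: "w \<in> A2" "antiadjacent T w (p ! k)"
        using swap.antineighbor_in_B1[OF kB] by (auto simp: antiadjacent_commute)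
      have "antiadjacent T w (p ! i)" if "0 < i" "Suc i < ?n" for i
      proof (cases "i = k")
        case False
        then have "p ! i \<in> X1" using that \<open>m = k\<close> by (intro in_X1) auto
        then have "p ! i \<in> B1 \<union> C1" using QX(1)[OF int[OF that]] disj(7) by blast
        then show ?thesis using anti w by blast
      qed (use w in simp)
      then show ?thesis using w by blast
    qed
    then obtain w where "w \<in> A2" "\<And>i. 0 < i \<Longrightarrow> Suc i < ?n \<Longrightarrow> antiadjacent T w (p ! i)" by blast
    then show False using odd_path_through_no_apex[OF Berge p, of w] ends A1_A2(1) by blast
  qed
  have no_antipath: "\<not> odd_path_through (tri_complement T) Q M p" for p
  proof
    assume p: "odd_path_through (tri_complement T) Q M p"
    let ?n = "length p"
    have n: "?n \<ge> 4" and path: "tri_path (tri_complement T) p"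
      and ends: "p ! 0 \<in> Q" "p ! (?n - 1) \<in> Q"
      and int: "\<And>i. 0 < i \<Longrightarrow> Suc i < ?n \<Longrightarrow> p ! i \<in> A1"
      using p by (auto simp: odd_path_through_iff M_def)
    \<comment> \<open>Each end of the antipath is adjacent to a nonconsecutive interior vertex in
      \<open>A1\<close>, which puts it in \<open>B1 \<union> C1\<close>. Thus \<open>a2\<close> is
      antiadjacent to the ends and adjacent to the interior, an apex in the complement.\<close>
    have "x \<in> B1 \<union> C1" if "adjacent T x y" "x \<in> Q" "y \<in> A1" for x y
      using that QX[of x] Q2[of x] cross_adjacent[of y x] sub disj(1) adjacent_commute[of T x y]
      by blast
    moreover have "adjacent T (p ! 0) (p ! 2)" "adjacent T (p ! (?n - 1)) (p ! 1)"
      using tri_path_nth_antiadjacent[OF path, of 0 2] n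
        tri_path_nth_antiadjacent[OF path, of 1 "?n - 1"] by (auto simp: adjacent_commute)
    ultimately have "p ! 0 \<in> B1 \<union> C1" "p ! (?n - 1) \<in> B1 \<union> C1"
      using ends int[of 1] int[of 2] n by auto
    then show False
      using odd_path_through_no_apex[of "tri_complement T", OF _ p, of a2] Berge anti[OF _ el(1)]
        int A1_A2(1)[OF _ el(1)] by simp
  qed
  have "balanced_skew_partition T ({a} \<union> Q) (M \<union> A2)"
  proof (rule balanced_skew_partitionI)
    show "strongly_complete T M A2"
      using A1_A2(2) by (auto simp: strongly_complete_def M_def)
    show "strongly_anticomplete T {a} Q" using Qa by (auto simp: strongly_anticomplete_def)
    have "\<not> odd_path_through T A2 Q p" for p
      using no_odd_path_through_apex[OF Berge, of A2 a Q] A2a Qa by blast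
    then show "\<not> odd_path_through T S R p" if "S \<in> {M, A2}" "R \<in> {{a}, Q}" for S R p
      using that no_path by auto
    have "\<not> odd_path_through (tri_complement T) Q A2 p" for p
      using no_odd_path_through_apex[of "tri_complement T" Q a A2] Berge A2a Qa by simp
    then show "\<not> odd_path_through (tri_complement T) R S p"
      if "S \<in> {M, A2}" "R \<in> {{a}, Q}" for S R p
      using that no_antipath by auto
    show "M \<union> A2 \<union> {a} \<union> Q = tverts T"
      using a verts(1) side1(1) side2(1) by (auto simp: M_def Q_def)
    have "A2 \<inter> Q = {}" "A1 \<inter> Q = {}" "a \<notin> A2"
      using Q1 Q2 sub disj(7) a unfolding Q_def by blast+
    then show "(M \<union> A2) \<inter> ({a} \<union> Q) = {}" by (auto simp: M_def)
    show "A2 \<noteq> {}" "Q \<noteq> {}" using el by (auto simp: Q_def)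
  qed (use trigraph \<open>M \<noteq> {}\<close> in auto)
  then show False using no_balanced by blast
qed

end

section \<open>Shortest paths\<close>

lemma tri_path_snoc:
  assumes p: "tri_path T p" and adj: "adjacent T (p ! (length p - 1)) x"
    and anti: "\<And>i. Suc i < length p \<Longrightarrow> antiadjacent T (p ! i) x"
  shows "tri_path T (p @ [x])"
proof -
  let ?n = "length p"
  have "p ! i \<noteq> x" if "i < ?n" for i
  proof (cases "i = ?n - 1")
    case True
    then show ?thesis using adj by auto
  next
    case False
    then have "antiadjacent T (p ! i) x" using that by (intro anti) simp
    then show ?thesis by auto
  qed
  then have "x \<notin> set p" by (auto simp: in_set_conv_nth)
  moreover have "if j = Suc i then adjacent T ((p @ [x]) ! i) ((p @ [x]) ! j)
      else antiadjacent T ((p @ [x]) ! i) ((p @ [x]) ! j)" if ij: "i < j" "j < length (p @ [x])" for i j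
  proof (cases "j < ?n")
    case True
    then show ?thesis
      using ij tri_path_nth_adjacent[OF p, of i] tri_path_nth_antiadjacent[OF p, of i j]
      by (auto simp: nth_append)
  next
    case False
    then have "j = ?n" using ij by simp
    then show ?thesis using ij adj anti[of i] by (auto simp: nth_append)
  qed
  moreover have "set (p @ [x]) \<subseteq> tverts T" "distinct p"
    using p adjacent_in_tverts[OF adj] by (auto simp: tri_path_def)
  ultimately show ?thesis unfolding tri_path_def by simp
qed

text \<open>Vertices may repeat, and the walk is a function with a number of steps: truncating,
  shifting and shortcutting are then mere reindexings, and a shortest walk is found by minimizing
  \<open>n\<close>.\<close>

definition connecting_walk ::
    "'a trigraph \<Rightarrow> 'a set \<Rightarrow> 'a set \<Rightarrow> 'a set \<Rightarrow> (nat \<Rightarrow> 'a) \<Rightarrow> nat \<Rightarrow> bool" where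
  "connecting_walk T X A B f n \<longleftrightarrow>
     f 0 \<in> A \<and> f n \<in> B \<and> (\<forall>i \<le> n. f i \<in> X) \<and> (\<forall>i < n. adjacent T (f i) (f (Suc i)))"

text \<open>In a shortest walk, a later visit to \<open>A\<close>, an earlier visit to
  \<open>B\<close>, a chord or a repeated vertex would each permit a shorter one.\<close>

lemma shortest_connecting_path:
  assumes T: "is_trigraph T" and X: "X \<subseteq> tverts T"
    and walk: "connecting_walk T X A B g m"
  obtains p where "tri_path T p" "set p \<subseteq> X" "p ! 0 \<in> A" "p ! (length p - 1) \<in> B"
    "\<And>i. 0 < i \<Longrightarrow> i < length p \<Longrightarrow> p ! i \<notin> A" "\<And>i. Suc i < length p \<Longrightarrow> p ! i \<notin> B"
proof -
  define n where "n = (LEAST n. \<exists>f. connecting_walk T X A B f n)"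
  have "\<exists>f. connecting_walk T X A B f n"
    unfolding n_def by (rule LeastI_ex) (use walk in blast)
  then obtain f where f: "connecting_walk T X A B f n" by blast
  have least: "n \<le> k" if "connecting_walk T X A B h k" for h k
    unfolding n_def by (rule Least_le) (use that in blast)
  have fX: "f i \<in> X" if "i \<le> n" for i using f that by (simp add: connecting_walk_def)
  have fadj: "adjacent T (f i) (f (Suc i))" if "i < n" for i
    using f that by (simp add: connecting_walk_def)
  have notB: "f i \<notin> B" if "i < n" for i
  proof
    assume "f i \<in> B"
    then have "connecting_walk T X A B f i" using f that by (auto simp: connecting_walk_def)
    then show False using least that by fastforce
  qed
  have notA: "f i \<notin> A" if "0 < i" "i \<le> n" for i
  proof
    assume "f i \<in> A"
    then have "connecting_walk T X A B (\<lambda>k. f (k + i)) (n - i)"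
      using f that by (auto simp: connecting_walk_def)
    then show False using least[of _ "n - i"] that by fastforce
  qed
  have nadj: "\<not> adjacent T (f i) (f j)" if ij: "Suc i < j" "j \<le> n" for i j
  proof
    assume adj: "adjacent T (f i) (f j)"
    \<comment> \<open>The walk jumps from \<open>f i\<close> directly to \<open>f j\<close>, saving
      \<open>j - Suc i\<close> steps.\<close>
    let ?g = "\<lambda>k. if k \<le> i then f k else f (k + (j - Suc i))"
    have "adjacent T (?g k) (?g (Suc k))" if "k < n - (j - Suc i)" for k
    proof -
      consider "k < i" | "k = i" | "i < k" by linarith
      then show ?thesis using that ij adj fadj[of k] fadj[of "k + (j - Suc i)"] by cases auto
    qed
    moreover have "?g k \<in> X" if "k \<le> n - (j - Suc i)" for k
      using that ij fX[of k] fX[of "k + (j - Suc i)"] by auto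
    moreover have "?g 0 \<in> A" "?g (n - (j - Suc i)) \<in> B"
      using f ij by (auto simp: connecting_walk_def)
    ultimately have "connecting_walk T X A B ?g (n - (j - Suc i))"
      unfolding connecting_walk_def by blast
    then show False using least[of ?g "n - (j - Suc i)"] ij by linarith
  qed
  have dist: "f i \<noteq> f j" if "i < j" "j \<le> n" for i j
  proof
    assume eq: "f i = f j"
    show False
    proof (cases "j = n")
      case True
      then show False using eq notB[of i] that f by (simp add: connecting_walk_def)
    next
      case False
      \<comment> \<open>A repetition before the last step yields the forbidden chord from
        \<open>f i\<close> to \<open>f (Suc j)\<close>.\<close>
      then show False using eq fadj[of j] nadj[of i "Suc j"] that by simp
    qed
  qed
  define p where "p = map f [0..<Suc n]"
  have len: "length p = Suc n" and nth: "\<And>i. i \<le> n \<Longrightarrow> p ! i = f i"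
    by (auto simp: p_def simp del: upt_Suc)
  have setp: "set p \<subseteq> X" using fX by (auto simp: p_def)
  have "inj_on f {0..<Suc n}"
  proof (rule inj_onI)
    fix x y assume "x \<in> {0..<Suc n}" "y \<in> {0..<Suc n}" "f x = f y"
    then show "x = y" using dist[of x y] dist[of y x] by (cases x y rule: linorder_cases) auto
  qed
  then have "distinct p" unfolding p_def by (simp add: distinct_map del: upt_Suc)
  moreover have "if j = Suc i then adjacent T (p ! i) (p ! j) else antiadjacent T (p ! i) (p ! j)"
    if ij: "i < j" "j < length p" for i j
  proof -
    have "antiadjacent T (f i) (f j)" if "j \<noteq> Suc i"
    proof -
      have "vpair T (f i) (f j)" using dist[of i j] fX[of i] fX[of j] X ij len by (auto simp: vpair_def)
      moreover have "\<not> adjacent T (f i) (f j)" using nadj[of i j] ij that len by auto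
      ultimately show ?thesis
        using strongly_antiadjacent_iff[OF T, of "f i" "f j"]
          strongly_antiadjacent_imp_antiadjacent[of T "f i" "f j"] by blast
    qed
    then show ?thesis using ij len nth[of i] nth[of j] fadj[of i] by auto
  qed
  moreover have "p \<noteq> []" using len by auto
  ultimately have "tri_path T p" unfolding tri_path_def using setp X by blast
  moreover have "p ! 0 \<in> A" "p ! (length p - 1) \<in> B"
    using f nth len by (auto simp: connecting_walk_def)
  ultimately show thesis using that setp nth notA notB len by auto
qed

section \<open>Components\<close>

abbreviation edge_rel :: "'a ugraph \<Rightarrow> ('a \<times> 'a) set" where
  "edge_rel G \<equiv> {(x, y). {x, y} \<in> uedges G}"

lemma sym_edge_rel: "sym (edge_rel G)"
  by (auto simp: sym_def insert_commute)

lemma ug_connected_via: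
  assumes "\<And>y. y \<in> uverts G \<Longrightarrow> (u, y) \<in> (edge_rel G)\<^sup>*"
  shows "ug_connected G"
  unfolding ug_connected_def
proof (intro ballI)
  fix x y assume xy: "x \<in> uverts G" "y \<in> uverts G"
  have "(x, u) \<in> (edge_rel G)\<^sup>*"
    using assms[OF xy(1)] by (rule symD[OF sym_rtrancl[OF sym_edge_rel]])
  also have "(u, y) \<in> (edge_rel G)\<^sup>*" using assms[OF xy(2)] .
  finally show "(x, y) \<in> (edge_rel G)\<^sup>*" .
qed

lemma ug_induced_simps [simp]:
  "uverts (ug_induced G K) = uverts G \<inter> K"
  "e \<in> uedges (ug_induced G K) \<longleftrightarrow> e \<in> uedges G \<and> e \<subseteq> K"
  by (auto simp: ug_induced_def)

text \<open>Maximality holds because a connected set containing \<open>u\<close> consists of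
  vertices reachable from \<open>u\<close>.\<close>

lemma reachable_component:
  assumes u: "u \<in> uverts G" and edges: "\<And>x y. {x, y} \<in> uedges G \<Longrightarrow> y \<in> uverts G"
  shows "{y. (u, y) \<in> (edge_rel G)\<^sup>*} \<in> ug_components G"
proof -
  define K where "K = {y. (u, y) \<in> (edge_rel G)\<^sup>*}"
  have "y \<in> uverts G" if "(u, y) \<in> (edge_rel G)\<^sup>*" for y
    using that by (induction rule: rtrancl_induct) (use u edges in auto)
  then have sub: "K \<subseteq> uverts G" by (auto simp: K_def)
  have "(u, y) \<in> (edge_rel (ug_induced G K))\<^sup>*" if "(u, y) \<in> (edge_rel G)\<^sup>*" for y
    using that
  proof (induction rule: rtrancl_induct)
    case (step y z)
    then have "(u, z) \<in> (edge_rel G)\<^sup>*" by (meson rtrancl.rtrancl_into_rtrancl)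
    then have "(y, z) \<in> edge_rel (ug_induced G K)" using step by (auto simp: K_def)
    then show ?case using step.IH by (meson rtrancl.rtrancl_into_rtrancl)
  qed simp
  then have "ug_connected (ug_induced G K)" by (intro ug_connected_via[of _ u]) (auto simp: K_def)
  moreover have "K' = K" if K': "K \<subseteq> K'" "K' \<subseteq> uverts G" "ug_connected (ug_induced G K')" for K'
  proof -
    have "y \<in> K" if "y \<in> K'" for y
    proof -
      have "u \<in> K'" using K' by (auto simp: K_def)
      then have "(u, y) \<in> (edge_rel (ug_induced G K'))\<^sup>*"
        using K' that u by (auto simp: ug_connected_def)
      moreover have "edge_rel (ug_induced G K') \<subseteq> edge_rel G" by auto
      ultimately show ?thesis using rtrancl_mono by (auto simp: K_def)
    qed
    then show ?thesis using K'(1) by blast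
  qed
  moreover have "u \<in> K" by (simp add: K_def)
  ultimately show ?thesis using sub unfolding K_def[symmetric] ug_components_def by blast
qed

lemma component_closed:
  assumes K: "K \<in> ug_components G" and x: "x \<in> K" and y: "y \<in> uverts G" "{x, y} \<in> uedges G"
  shows "y \<in> K"
proof -
  let ?H = "ug_induced G (insert y K)"
  have conn: "ug_connected (ug_induced G K)" and sub: "K \<subseteq> uverts G"
    and maxim: "\<And>K'. K \<subseteq> K' \<Longrightarrow> K' \<subseteq> uverts G \<Longrightarrow> ug_connected (ug_induced G K') \<Longrightarrow> K' = K"
    using K by (auto simp: ug_components_def)
  have "(x, z) \<in> (edge_rel ?H)\<^sup>*" if "z \<in> K" for z
  proof -
    have "(x, z) \<in> (edge_rel (ug_induced G K))\<^sup>*"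
      using conn sub x that by (auto simp: ug_connected_def)
    moreover have "edge_rel (ug_induced G K) \<subseteq> edge_rel ?H" by auto
    ultimately show ?thesis using rtrancl_mono by blast
  qed
  moreover have "(x, y) \<in> edge_rel ?H" using x y by auto
  ultimately have "ug_connected ?H" by (intro ug_connected_via[of _ x]) auto
  then have "insert y K = K" using maxim[of "insert y K"] sub y by blast
  then show ?thesis by blast
qed

text \<open>A third switchable partner would give the component of \<open>v\<close> three switchable
  edges. So \<open>v\<close> has degree exactly two, and the degree-two clause of the class
  applies.\<close>

lemma class_F_two_switchable:
  assumes F: "T \<in> class_F" and sw: "switchable T v x" "switchable T v y" and "x \<noteq> y"
  shows "(\<forall>u \<in> tverts T - {v, x, y}. strongly_adjacent T v u) \<or>
    (\<forall>u \<in> tverts T - {v, x, y}. strongly_antiadjacent T v u)"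
proof -
  let ?S = "switchable_graph T"
  have v: "v \<in> tverts T" using sw by (simp add: switchable_def vpair_def)
  have nb: "ug_neighbors ?S v = {x, y}"
  proof (rule ccontr)
    assume "ug_neighbors ?S v \<noteq> {x, y}"
    moreover have "{x, y} \<subseteq> ug_neighbors ?S v"
      using sw by (auto simp: ug_neighbors_def switchable_commute)
    ultimately obtain z where z: "switchable T v z" "z \<noteq> x" "z \<noteq> y"
      by (auto simp: ug_neighbors_def switchable_commute)
    define K where "K = {y. (v, y) \<in> (edge_rel ?S)\<^sup>*}"
    have K: "K \<in> ug_components ?S"
      unfolding K_def using v by (intro reachable_component) (auto simp: switchable_def vpair_def)
    let ?E = "uedges (ug_induced ?S K)"
    have "(v, w) \<in> (edge_rel ?S)\<^sup>*" if "switchable T v w" for w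
      using that by (intro r_into_rtrancl) simp
    then have "{v, x} \<in> ?E" "{v, y} \<in> ?E" "{v, z} \<in> ?E" using sw z by (auto simp: K_def)
    moreover have "finite ?E"
    proof (rule finite_subset)
      show "?E \<subseteq> Pow (tverts T)" by (auto simp: switchable_graph_def switchable_def vpair_def)
      show "finite (Pow (tverts T))" using F by (simp add: class_F_def is_trigraph_def)
    qed
    ultimately have "card {{v, x}, {v, y}, {v, z}} \<le> card ?E" by (intro card_mono) auto
    moreover have "card {{v, x}, {v, y}, {v, z}} = 3"
      using z \<open>x \<noteq> y\<close> by (auto simp: doubleton_eq_iff)
    moreover have "card ?E \<le> 2" using F K by (auto simp: class_F_def)
    ultimately show False by simp
  qed
  then have "ug_degree ?S v = 2" using \<open>x \<noteq> y\<close> by (simp add: ug_degree_def)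
  moreover have "\<forall>v \<in> tverts T. \<forall>x y. ug_degree ?S v = 2 \<and> ug_neighbors ?S v = {x, y} \<longrightarrow>
      strongly_complete T {v} (tverts T - {v, x, y}) \<or>
      strongly_anticomplete T {v} (tverts T - {v, x, y})"
    using F unfolding class_F_def by blast
  ultimately show ?thesis
    using v nb unfolding strongly_complete_def strongly_anticomplete_def by blast
qed

section \<open>The properties of one side\<close>

context unbalanced_two_join
begin

text \<open>The set reachable from \<open>A1\<close> inside \<open>X1\<close> is closed, so
  \<open>closed_meets_B1\<close> makes it reach \<open>B1\<close>; a shortest walk is then the
  path.\<close>

lemma connecting_path:
  obtains p where "tri_path T p" "set p \<subseteq> X1" "p ! 0 \<in> A1" "p ! (length p - 1) \<in> B1"
    "\<And>i. 0 < i \<Longrightarrow> i < length p \<Longrightarrow> p ! i \<notin> A1" "\<And>i. Suc i < length p \<Longrightarrow> p ! i \<notin> B1"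
proof -
  define K where "K = {y. \<exists>f n. connecting_walk T X1 A1 {y} f n}"
  obtain a where a: "a \<in> A1" using side1(5) by blast
  then have "connecting_walk T X1 A1 {a} (\<lambda>_. a) 0" using sub by (auto simp: connecting_walk_def)
  then have "a \<in> K" by (auto simp: K_def)
  moreover have "K \<subseteq> X1" by (auto simp: K_def connecting_walk_def)
  moreover have "z \<in> K" if y: "y \<in> K" and z: "z \<in> X1" "adjacent T y z" for y z
  proof -
    obtain f n where f: "connecting_walk T X1 A1 {y} f n" using y by (auto simp: K_def)
    then have "connecting_walk T X1 A1 {z} (f(Suc n := z)) (Suc n)"
      using z by (auto simp: connecting_walk_def less_Suc_eq le_Suc_eq)
    then show ?thesis by (auto simp: K_def)
  qed
  ultimately have "K \<inter> B1 \<noteq> {}" using closed_meets_B1[of K a] by blast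
  then obtain b f n where "b \<in> B1" "connecting_walk T X1 A1 {b} f n" by (auto simp: K_def)
  then have "connecting_walk T X1 A1 B1 f n" by (simp add: connecting_walk_def)
  moreover have "X1 \<subseteq> tverts T" using verts by blast
  ultimately show thesis using shortest_connecting_path[OF trigraph] that by metis
qed

text \<open>A path across \<open>X\<^sub>2\<close> closes up both with \<open>a, b\<close> and with \<open>a, c, b\<close>, and one of these two
  holes is odd.\<close>

lemma no_switchable_triangle:
  assumes abc: "a \<in> A1" "b \<in> B1" "c \<in> C1"
    and adj: "switchable T a b" "adjacent T a c" "adjacent T c b"
  shows False
proof -
  obtain p where p: "tri_path T p" "set p \<subseteq> X2" "p ! 0 \<in> A2" "p ! (length p - 1) \<in> B2"
    and pA: "\<And>i. 0 < i \<Longrightarrow> i < length p \<Longrightarrow> p ! i \<notin> A2"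
    and pB: "\<And>i. Suc i < length p \<Longrightarrow> p ! i \<notin> B2"
    using unbalanced_two_join.connecting_path[OF swap_12] by metis
  let ?n = "length p"
  have "p \<noteq> []" using p(1) by (simp add: tri_path_def)
  moreover have "?n \<noteq> 1" using p(3,4) disj(4) by auto
  ultimately have n: "?n \<ge> 2" by (cases p rule: remdups_adj.cases) auto
  have pX: "p ! i \<in> X2" if "i < ?n" for i using p(2) that nth_mem by blast
  have X: "a \<in> X1" "b \<in> X1" "c \<in> X1" "a \<notin> B1" "b \<notin> A1" "c \<notin> A1" "c \<notin> B1"
    using abc sub disj(1-3) by blast+
  have ab: "adjacent T a b" "antiadjacent T a b" using adj(1) by (auto simp: switchable_iff)
  have a_p: "adjacent T a (p ! 0)" using cross_adjacent[of a "p ! 0"] X abc p(3) sub by blast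
  have b_p: "adjacent T (p ! (?n - 1)) b"
    using cross_adjacent[of b "p ! (?n - 1)"] X abc p(4) sub by (auto simp: adjacent_commute)
  have a_anti: "antiadjacent T a (p ! i)" if "0 < i" "i < ?n" for i
    using cross_antiadjacent[of a "p ! i"] X pX[of i] pA[of i] that by blast
  have b_anti: "antiadjacent T (p ! i) b" if "Suc i < ?n" for i
    using cross_antiadjacent[of b "p ! i"] X pX[of i] pB[of i] that
    by (simp add: antiadjacent_commute)
  have c_anti: "antiadjacent T (p ! i) c" if "i < ?n" for i
    using cross_antiadjacent[of c "p ! i"] X pX[of i] that by (simp add: antiadjacent_commute)
  have pb: "tri_path T (p @ [b])" using p(1) b_p b_anti by (rule tri_path_snoc)
  have pbc: "tri_path T ((p @ [b]) @ [c])"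
    using adj(3) c_anti by (intro tri_path_snoc[OF pb]) (auto simp: nth_append adjacent_commute)
  show False
  proof (cases "even ?n")
    case False
    \<comment> \<open>For odd \<open>?n\<close> the hole is \<open>a\<close>, \<open>p\<close>,
      \<open>b\<close>, of length \<open>?n + 2\<close>, using \<open>a\<close> and \<open>b\<close>
      as adjacent.\<close>
    then have "?n \<ge> 3" using n by presburger
    then have "odd_path_through T UNIV UNIV (p @ [b])"
      using pb False by (simp add: odd_path_through_iff)
    then show False
    proof (rule odd_path_through_no_apex[OF Berge, of _ _ _ a])
      show "antiadjacent T a ((p @ [b]) ! i)" if "0 < i" "Suc i < length (p @ [b])" for i
        using that a_anti[of i] by (simp add: nth_append)
    qed (use a_p ab n in \<open>auto simp: nth_append\<close>)
  next
    case True
    \<comment> \<open>For even \<open>?n\<close> the hole is \<open>a\<close>, \<open>p\<close>,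
      \<open>b\<close>, \<open>c\<close>, of length \<open>?n + 3\<close>, using \<open>a\<close>
      and \<open>b\<close> as antiadjacent.\<close>
    then have "odd_path_through T UNIV UNIV ((p @ [b]) @ [c])"
      using pbc n by (simp add: odd_path_through_iff)
    then show False
    proof (rule odd_path_through_no_apex[OF Berge, of _ _ _ a])
      show "antiadjacent T a (((p @ [b]) @ [c]) ! i)" if "0 < i" "Suc i < length ((p @ [b]) @ [c])" for i
        using that ab a_anti[of i] by (cases "i = ?n") (auto simp: nth_append)
    qed (use a_p adj(2) n in \<open>auto simp: nth_append\<close>)
  qed
qed

text \<open>The star formed by \<open>a\<close> and \<open>A2\<close> would isolate \<open>c\<close>
  from \<open>b2\<close>. This supplies both edges at \<open>c\<close> when \<open>X1\<close> has
  three vertices.\<close>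

lemma no_pendant_vertex:
  assumes ac: "a \<in> A1" "c \<in> C1" and nadj: "\<And>u. u \<in> X1 \<Longrightarrow> u \<noteq> a \<Longrightarrow> \<not> adjacent T c u"
  shows False
proof -
  obtain a2 b2 where el: "a2 \<in> A2" "b2 \<in> B2" using side2(5,6) by blast
  show False
  proof (rule no_star_cutset[where v = a and B = "insert a A2" and P = "{c}"])
    show "b2 \<notin> insert a A2" "b2 \<notin> {c}" "a2 \<noteq> a" "{c} \<inter> insert a A2 = {}"
      using el ac sub disj by blast+
    show "antiadjacent T a b2" using el ac sub cross_antiadjacent[of a b2] disj(1,4) by blast
    show "\<not> adjacent T x q" if "x \<in> {c}" "q \<in> tverts T" "q \<notin> {c}" "q \<notin> insert a A2" for x q
      using that nadj[of q] in_tverts_cases[of q] cross_adjacent[of c q] ac sub disj(2,3) by blast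
  qed (use el ac in_tverts cross_strongly_adjacent(1) in auto)
qed

text \<open>If \<open>B1 = {b}\<close>, every vertex of \<open>A1\<close> has both a neighbor and an
  antineighbor in \<open>B1\<close>, so \<open>b\<close> is in two switchable pairs. The class then
  makes \<open>b\<close> strongly complete or strongly anticomplete to the rest, against
  \<open>a2\<close> and \<open>b2\<close> respectively.\<close>

lemma card_B1_ge_2:
  assumes F: "T \<in> class_F" and "C1 = {}"
  shows "card B1 \<ge> 2"
proof (rule ccontr)
  assume "\<not> card B1 \<ge> 2"
  moreover have "finite B1" using trigraph in_tverts(2)
    by (meson finite_subset is_trigraph_def subsetI)
  ultimately have "card B1 = 1" using side1(6) by (metis One_nat_def card_0_eq less_2_cases not_le)
  then obtain b where b: "B1 = {b}" using card_1_singletonE by blast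
  have sw: "switchable T b a" if "a \<in> A1" for a
    using antineighbor_in_B1[OF that] neighbor_outside_A1[OF that] b assms(2)
    by (auto simp: switchable_iff adjacent_commute antiadjacent_commute)
  obtain a where a: "a \<in> A1" using side1(5) by blast
  obtain a' where a': "a' \<in> A1" "a' \<noteq> a"
    using side1_not_pair[of a b] in_X1_cases b assms(2) by blast
  obtain a2 b2 where el: "a2 \<in> A2" "b2 \<in> B2" using side2(5,6) by blast
  have bB: "b \<in> B1" using b by simp
  have X: "a2 \<notin> X1" "b2 \<notin> X1" "a \<in> X1" "a' \<in> X1" "b \<in> X1"
    using el a a'(1) bB sub disj(7) by blast+
  have ne: "a2 \<in> tverts T - {b, a, a'}" "b2 \<in> tverts T - {b, a, a'}"
    using X in_tverts el by auto
  have "antiadjacent T b a2" "adjacent T b b2"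
    using cross_antiadjacent[of b a2] cross_adjacent[of b b2] el bB sub disj(1,4) by blast+
  then show False
    using class_F_two_switchable[OF F sw[OF a] sw[OF a'(1)]] a' ne
      strongly_adjacent_iff[OF trigraph, of b a2] strongly_antiadjacent_iff[OF trigraph, of b b2] by blast
qed

lemma side_properties:
  assumes F: "T \<in> class_F"
    and not_path: "card A1 = 1 \<and> card B1 = 1 \<Longrightarrow>
      \<not> (\<exists>p. ug_is_path (full_realization (tri_induced T X1)) p \<and> path_length p = 2 \<and>
             hd p \<in> A1 \<and> last p \<in> B1)"
  shows "(\<forall>v \<in> X1. \<exists>u \<in> X1. adjacent T v u) \<and>
    (\<forall>a \<in> A1. \<exists>b \<in> B1. antiadjacent T a b) \<and>
    (\<forall>b \<in> B1. \<exists>a \<in> A1. antiadjacent T b a) \<and>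
    (\<forall>a \<in> A1. \<exists>u \<in> C1 \<union> B1. adjacent T a u) \<and>
    (\<forall>b \<in> B1. \<exists>u \<in> C1 \<union> A1. adjacent T b u) \<and>
    (C1 = {} \<longrightarrow> card A1 \<ge> 2 \<and> card B1 \<ge> 2) \<and>
    card X1 \<ge> 4"
proof -
  interpret swap: unbalanced_two_join T X1 B1 A1 C1 X2 B2 A2 C2 by (rule swap_AB)
  have nb: "\<exists>u \<in> X1. adjacent T v u" if v: "v \<in> X1" for v
  proof (rule ccontr)
    assume "\<not> ?thesis"
    then have "{v} \<inter> B1 \<noteq> {}" "{v} \<inter> A1 \<noteq> {}"
      using closed_meets_B1[of "{v}" v] swap.closed_meets_B1[of "{v}" v] v by blast+
    then show False using disj(1) by blast
  qed
  have ge2: "card A1 \<ge> 2 \<and> card B1 \<ge> 2" if "C1 = {}"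
    using card_B1_ge_2[OF F that] swap.card_B1_ge_2[OF F that] by blast
  have "card X1 \<ge> 4"
  proof (rule ccontr)
    assume "\<not> card X1 \<ge> 4"
    then have X3: "card X1 = 3" using side1(7) by linarith
    have "finite X1" using X3 by (metis card.infinite zero_neq_numeral)
    then have fin: "finite A1" "finite B1" "finite C1" using sub by (auto intro: finite_subset)
    have "card X1 = card (A1 \<union> B1) + card C1"
      unfolding side1(1) using fin side1(2-4) by (intro card_Un_disjoint) auto
    also have "card (A1 \<union> B1) = card A1 + card B1"
      using fin side1(2) by (intro card_Un_disjoint) auto
    finally have sum: "card A1 + card B1 + card C1 = 3" using X3 by simp
    \<comment> \<open>An empty \<open>C1\<close> would already force four vertices in
      \<open>A1 \<union> B1\<close>; hence all three parts are singletons.\<close>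
    moreover have "C1 \<noteq> {}" using ge2 sum by auto
    then have "card A1 \<noteq> 0" "card B1 \<noteq> 0" "card C1 \<noteq> 0" using fin side1(5,6) by auto
    ultimately have ones: "card A1 = 1" "card B1 = 1" "card C1 = 1" by linarith+
    obtain a b c where abc: "A1 = {a}" "B1 = {b}" "C1 = {c}"
      using ones by (meson card_1_singletonE)
    have el: "a \<in> A1" "b \<in> B1" "c \<in> C1" using abc by auto
    have X1_eq: "X1 = {a, b, c}" using side1(1) abc by auto
    have ne: "a \<noteq> b" "a \<noteq> c" "b \<noteq> c" using el disj(1-3) by blast+
    have ac: "adjacent T c a" using swap.no_pendant_vertex[OF el(2,3)] X1_eq by fastforce
    have cb: "adjacent T c b" using no_pendant_vertex[OF el(1,3)] X1_eq by fastforce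
    have anti: "antiadjacent T a b" using antineighbor_in_B1[OF el(1)] abc by auto
    show False
    \<comment> \<open>Either \<open>a\<close> and \<open>b\<close> form a switchable pair completing
      a triangle with \<open>c\<close>, or \<open>X1\<close> is precisely the path of length two
      excluded by \<open>not_path\<close>.\<close>
    proof (cases "adjacent T a b")
      case True
      then show False
        using no_switchable_triangle[OF el] anti ac cb
        by (auto simp: switchable_iff adjacent_commute)
    next
      case False
      let ?G = "full_realization (tri_induced T X1)"
      have "uedges ?G = {{a, c}, {c, b}}"
      proof
        show "uedges ?G \<subseteq> {{a, c}, {c, b}}"
          using False X1_eq adjacent_commute[of T a b] by (auto simp: full_realization_def)
        show "{{a, c}, {c, b}} \<subseteq> uedges ?G"
          using ac cb X1_eq by (auto simp: adjacent_commute)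
      qed
      moreover have "{{[a, c, b] ! i, [a, c, b] ! Suc i} | i. Suc i < length [a, c, b]} = {{a, c}, {c, b}}"
        by (auto simp: less_Suc_eq conj_disj_distribL ex_disj_distrib)
      moreover have "uverts ?G = {a, c, b}" using X1_eq el in_tverts by auto
      ultimately have "ug_is_path ?G [a, c, b]" using ne by (auto simp: ug_is_path_def)
      moreover have "path_length [a, c, b] = 2" by (simp add: path_length_def)
      ultimately show False using not_path ones el
        by (metis last.simps list.distinct(1) list.sel(1))
    qed
  qed
  then show ?thesis
    using nb ge2 antineighbor_in_B1 swap.antineighbor_in_B1 neighbor_outside_A1
      swap.neighbor_outside_A1 by blast
qed

lemma component_meets_A1_and_B1:
  assumes K: "K \<in> tri_components (tri_induced T X1)"
  shows "K \<inter> A1 \<noteq> {} \<and> K \<inter> B1 \<noteq> {}"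
proof -
  interpret swap: unbalanced_two_join T X1 B1 A1 C1 X2 B2 A2 C2 by (rule swap_AB)
  have K': "K \<in> ug_components (full_realization (tri_induced T X1))"
    using K by (simp add: tri_components_def)
  then obtain k where k: "k \<in> K" "K \<subseteq> X1" by (auto simp: ug_components_def)
  have "\<not> adjacent T x y" if "x \<in> K" "y \<in> X1" "y \<notin> K" for x y
    using component_closed[OF K' that(1), of y] that k adjacent_in_tverts[of T x y] by auto
  then show ?thesis
    using closed_meets_B1[OF k(2,1)] swap.closed_meets_B1[OF k(2,1)] by blast
qed

end

section \<open>From splits to the theorem\<close>

lemma two_join_split_imp_unbalanced:
  assumes "T \<in> class_F" "\<not> (\<exists>A B. balanced_skew_partition T A B)"
    and split: "two_join_split T X1 X2 A1 B1 C1 A2 B2 C2"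
  shows "unbalanced_two_join T X1 A1 B1 C1 X2 A2 B2 C2"
proof
  show T: "is_trigraph T" "Berge T" using assms by (auto simp: class_F_def)
  show "\<not> switchable T x y" if "x \<in> X1" "y \<in> X2" for x y
    using split that by (auto simp: two_join_split_def)
  \<comment> \<open>Without switchable pairs across the join, adjacency and strong adjacency
    coincide there.\<close>
  then have "adjacent T x y \<longleftrightarrow> strongly_adjacent T x y" if "x \<in> X1" "y \<in> X2" for x y
    using that by (auto simp: adjacent_def strongly_adjacent_def switchable_def)
  then show "adjacent T x y \<longleftrightarrow> (x \<in> A1 \<and> y \<in> A2) \<or> (x \<in> B1 \<and> y \<in> B2)"
    if "x \<in> X1" "y \<in> X2" for x y
    using split that by (auto simp: two_join_split_def strongly_complete_def)
qed (use assms in \<open>auto simp: two_join_split_def two_join_side_def\<close>)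

theorem theorem3p1:
  fixes T :: "'a trigraph"
    and X1 X2 A1 B1 C1 A2 B2 C2 :: "'a set"
  assumes "T \<in> class_F"
    and "\<not> (\<exists>A B. balanced_skew_partition T A B)"
    and "two_join_split T X1 X2 A1 B1 C1 A2 B2 C2"
  shows "proper_two_join T X1 X2 \<and>
    (\<forall>(X, A, B, C) \<in> {(X1, A1, B1, C1), (X2, A2, B2, C2)}.
       (\<forall>v \<in> X. \<exists>u \<in> X. adjacent T v u) \<and>
       (\<forall>a \<in> A. \<exists>b \<in> B. antiadjacent T a b) \<and>
       (\<forall>b \<in> B. \<exists>a \<in> A. antiadjacent T b a) \<and>
       (\<forall>a \<in> A. \<exists>u \<in> C \<union> B. adjacent T a u) \<and>
       (\<forall>b \<in> B. \<exists>u \<in> C \<union> A. adjacent T b u) \<and>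
       (C = {} \<longrightarrow> card A \<ge> 2 \<and> card B \<ge> 2) \<and>
       card X \<ge> 4)"
proof -
  \<comment> \<open>Stated for an arbitrary split, because properness quantifies over all splits of
    \<open>(X1, X2)\<close>.\<close>
  have loc: "unbalanced_two_join T X1 A1' B1' C1' X2 A2' B2' C2'"
    if "two_join_split T X1 X2 A1' B1' C1' A2' B2' C2'" for A1' B1' C1' A2' B2' C2'
    using two_join_split_imp_unbalanced[OF assms(1,2) that] .
  have "proper_two_join T X1 X2"
    unfolding proper_two_join_def
  proof (intro conjI allI impI ballI)
    show "two_join T X1 X2" using assms(3) unfolding two_join_def by blast
  next
    fix A1' B1' C1' A2' B2' C2' K
    assume "two_join_split T X1 X2 A1' B1' C1' A2' B2' C2'"
    then interpret unbalanced_two_join T X1 A1' B1' C1' X2 A2' B2' C2' by (rule loc)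
    interpret swap: unbalanced_two_join T X2 A2' B2' C2' X1 A1' B1' C1' by (rule swap_12)
    show "K \<inter> A1' \<noteq> {}" "K \<inter> B1' \<noteq> {}" if "K \<in> tri_components (tri_induced T X1)"
      using component_meets_A1_and_B1[OF that] by auto
    show "K \<inter> A2' \<noteq> {}" "K \<inter> B2' \<noteq> {}" if "K \<in> tri_components (tri_induced T X2)"
      using swap.component_meets_A1_and_B1[OF that] by auto
  qed
  moreover have "two_join_side T X1 A1 B1 C1" "two_join_side T X2 A2 B2 C2"
    using assms(3) by (auto simp: two_join_split_def)
  then have "card A1 = 1 \<and> card B1 = 1 \<Longrightarrow>
      \<not> (\<exists>p. ug_is_path (full_realization (tri_induced T X1)) p \<and> path_length p = 2 \<and>
             hd p \<in> A1 \<and> last p \<in> B1)"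
    and "card A2 = 1 \<and> card B2 = 1 \<Longrightarrow>
      \<not> (\<exists>p. ug_is_path (full_realization (tri_induced T X2)) p \<and> path_length p = 2 \<and>
             hd p \<in> A2 \<and> last p \<in> B2)"
    by (simp_all add: two_join_side_def)
  note unbalanced_two_join.side_properties[OF loc[OF assms(3)] assms(1) this(1)]
    unbalanced_two_join.side_properties[OF unbalanced_two_join.swap_12[OF loc[OF assms(3)]]
      assms(1) this(2)]
  ultimately show ?thesis by simp
qed

end
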